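(* Let $L\xrightarrow{\partial_2}M\xrightarrow{\partial_1}N$ with Peiffer lifting $\{-,-\}$ be a 2-crossed module of groups and $K$ a field. With the quotient algebras $\overline{K(L\rtimes M\rtimes N)}=K(L\rtimes M\rtimes N)/J_2$ and $\overline{K(1\rtimes M\rtimes N)}=K(1\rtimes M\rtimes N)/J_1$, and the maps $\overline{\sigma}_3(\overline{\mathbf{e}}_{l,m,n})=\overline{\mathbf{e}}_{1,m,n}$, $\overline{\tau}_3(\overline{\mathbf{e}}_{l,m,n})=\overline{\mathbf{e}}_{1,\partial_2(l)m,n}$, $\overline{i}_3(\overline{\mathbf{e}}_{1,m,n})=\overline{\mathbf{e}}_{1,m,n}$, $\overline{\sigma}_2(\overline{\mathbf{e}}_{1,m,n})=\mathbf{e}_{1,1,n}$, $\overline{\tau}_2(\overline{\mathbf{e}}_{1,m,n})=\mathbf{e}_{1,1,\partial_1(m)n}$, $\overline{i}_2(\mathbf{e}_{1,1,n})=\overline{\mathbf{e}}_{1,1,n}$ (all well-defined algebra homomorphisms): (a) $\overline{K(1\rtimes M\rtimes N)}\rightrightarrows K(1\rtimes1\rtimes N)$, with structural maps $\overline{\sigma}_2,\overline{\tau}_2,\overline{i}_2$, is a pre-cat$^1$-algebra; (b) $\overline{K(L\rtimes M\rtimes N)}\rightrightarrows\overline{K(1\rtimes M\rtimes N)}$, with structural maps $\overline{\sigma}_3,\overline{\tau}_3,\overline{i}_3$, is a cat$^1$-algebra.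
   Context: A 2-crossed module $(L\xrightarrow{\partial_2}M\xrightarrow{\partial_1}N,\{-,-\})$ is a complex of groups ($\partial_1\partial_2=1$) with left actions of $N$ on $M$ and $L$ such that $\partial_2,\partial_1$ are $N$-equivariant ($N$ acting on itself by conjugation), and a function $\{-,-\}:M\times M\to L$ satisfying: $\partial_2\{m,m'\}=({}^{\partial_1m}m')mm'^{-1}m^{-1}$; $\{\partial_2l,\partial_2l'\}=[l',l]$; $\{mm',m''\}={}^{\partial_1m}\{m',m''\}\{m,m'm''m'^{-1}\}$; $\{m,m'm''\}=\{m,m'\}\,{}^{mm'm^{-1}}\{m,m''\}$; $\{m,\partial_2l\}\{\partial_2l,m\}={}^{\partial_1m}l\,l^{-1}$; ${}^n\{m,m'\}=\{{}^nm,{}^nm'\}$. Here $M$ acts on $L$ by ${}^ml=\{\partial_2l,m\}l$. $L\rtimes M\rtimes N$ has multiplication $(l,m,n)(l',m',n')=(l\,{}^m({}^nl'),m\,{}^nm',nn')$; $1\rtimes M\rtimes N$ and $1\rtimes1\rtimes N$ are the evident subgroups. $K(G)$ denotes the group algebra with basis $\{\mathbf{e}_g\}_{g\in G}$. $J_2$ is the two-sided ideal of $K(L\rtimes M\rtimes N)$ generated by all elements $\mathbf{e}_{l'l,m,n}-\mathbf{e}_{l,m,n}-\mathbf{e}_{l',\partial_2(l)m,n}+\mathbf{e}_{1,\partial_2(l)m,n}$, $\mathbf{e}_{l'\,{}^{m'}l,m'm,n}-\mathbf{e}_{l,m,n}-\mathbf{e}_{l',m',\partial_1(m)n}+\mathbf{e}_{1,1,\partial_1(m)n}$,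 $\mathbf{e}_{1,m'm,n}-\mathbf{e}_{1,m,n}-\mathbf{e}_{1,m',\partial_1(m)n}+\mathbf{e}_{1,1,\partial_1(m)n}$ ($l,l'\in L$, $m,m'\in M$, $n\in N$), and $J_1$ is the ideal of $K(1\rtimes M\rtimes N)$ generated by all elements of the last form. Bars denote cosets. A pre-cat$^1$-algebra consists of $K$-algebras $\mathcal{A}_1,\mathcal{A}_0$ and algebra morphisms $\sigma,\tau:\mathcal{A}_1\to\mathcal{A}_0$, $i:\mathcal{A}_0\to\mathcal{A}_1$ with $\sigma i=\tau i=\mathrm{id}_{\mathcal{A}_0}$. It is a cat$^1$-algebra if moreover $\mathrm{Ker}\,\sigma\cdot\mathrm{Ker}\,\tau=0$ and $\mathrm{Ker}\,\tau\cdot\mathrm{Ker}\,\sigma=0$ (kernel condition). *)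

theory Defs
  imports
    "HOL-Algebra.Ring"
    "HOL-Algebra.Module"
    "HOL-Algebra.Ideal"
    "HOL-Algebra.QuotRing"
    "HOL-Algebra.Ideal_Product"
    "HOL-Algebra.Bij"
begin

section \<open>2-crossed modules of groups\<close>

record ('l, 'm, 'n) two_crossed_data =
  grpL :: "'l monoid"
  grpM :: "'m monoid"
  grpN :: "'n monoid"
  bd2 :: "'l \<Rightarrow> 'm"
  bd1 :: "'m \<Rightarrow> 'n"
  actM :: "'n \<Rightarrow> 'm \<Rightarrow> 'm"
  actL :: "'n \<Rightarrow> 'l \<Rightarrow> 'l"
  peiffer :: "'m \<Rightarrow> 'm \<Rightarrow> 'l"

text \<open>The action of \<open>M\<close> on \<open>L\<close> that is derived from the Peiffer lifting.\<close>

definition actML :: "('l, 'm, 'n) two_crossed_data \<Rightarrow> 'm \<Rightarrow> 'l \<Rightarrow> 'l" where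
  "actML X m l = peiffer X (bd2 X l) m \<otimes>\<^bsub>grpL X\<^esub> l"

text \<open>Actions of \<open>N\<close> are by group automorphisms.  Elements of \<^const>\<open>AutoGroup\<close> are
  extensional functions; this only normalises the values off the carrier.  The commutator is
  \<open>[a, b] = a b a\<^sup>-\<^sup>1 b\<^sup>-\<^sup>1\<close>; this convention is forced by the first two laws of the lifting.\<close>

locale two_crossed_module =
  fixes X :: "('l, 'm, 'n) two_crossed_data"
  assumes group_L: "group (grpL X)"
    and group_M: "group (grpM X)"
    and group_N: "group (grpN X)"
    and bd2_hom: "bd2 X \<in> hom (grpL X) (grpM X)"
    and bd1_hom: "bd1 X \<in> hom (grpM X) (grpN X)"
    and complex: "l \<in> carrier (grpL X) \<Longrightarrow> bd1 X (bd2 X l) = \<one>\<^bsub>grpN X\<^esub>"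
    and actM_hom: "actM X \<in> hom (grpN X) (AutoGroup (grpM X))"
    and actL_hom: "actL X \<in> hom (grpN X) (AutoGroup (grpL X))"
    and bd2_equivariant:
      "\<lbrakk>n \<in> carrier (grpN X); l \<in> carrier (grpL X)\<rbrakk>
        \<Longrightarrow> bd2 X (actL X n l) = actM X n (bd2 X l)"
    and bd1_equivariant:
      "\<lbrakk>n \<in> carrier (grpN X); m \<in> carrier (grpM X)\<rbrakk>
        \<Longrightarrow> bd1 X (actM X n m) = n \<otimes>\<^bsub>grpN X\<^esub> bd1 X m \<otimes>\<^bsub>grpN X\<^esub> inv\<^bsub>grpN X\<^esub> n"
    and peiffer_closed:
      "\<lbrakk>m \<in> carrier (grpM X); m' \<in> carrier (grpM X)\<rbrakk> \<Longrightarrow> peiffer X m m' \<in> carrier (grpL X)"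
    and bd2_peiffer:
      "\<lbrakk>m \<in> carrier (grpM X); m' \<in> carrier (grpM X)\<rbrakk>
        \<Longrightarrow> bd2 X (peiffer X m m') =
          actM X (bd1 X m) m' \<otimes>\<^bsub>grpM X\<^esub> m \<otimes>\<^bsub>grpM X\<^esub> inv\<^bsub>grpM X\<^esub> m' \<otimes>\<^bsub>grpM X\<^esub> inv\<^bsub>grpM X\<^esub> m"
    and peiffer_bd2_bd2:
      "\<lbrakk>l \<in> carrier (grpL X); l' \<in> carrier (grpL X)\<rbrakk>
        \<Longrightarrow> peiffer X (bd2 X l) (bd2 X l') =
          l' \<otimes>\<^bsub>grpL X\<^esub> l \<otimes>\<^bsub>grpL X\<^esub> inv\<^bsub>grpL X\<^esub> l' \<otimes>\<^bsub>grpL X\<^esub> inv\<^bsub>grpL X\<^esub> l"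
    and peiffer_mult_left:
      "\<lbrakk>m \<in> carrier (grpM X); m' \<in> carrier (grpM X); m'' \<in> carrier (grpM X)\<rbrakk>
        \<Longrightarrow> peiffer X (m \<otimes>\<^bsub>grpM X\<^esub> m') m'' =
          actL X (bd1 X m) (peiffer X m' m'') \<otimes>\<^bsub>grpL X\<^esub>
          peiffer X m (m' \<otimes>\<^bsub>grpM X\<^esub> m'' \<otimes>\<^bsub>grpM X\<^esub> inv\<^bsub>grpM X\<^esub> m')"
    and peiffer_mult_right:
      "\<lbrakk>m \<in> carrier (grpM X); m' \<in> carrier (grpM X); m'' \<in> carrier (grpM X)\<rbrakk>
        \<Longrightarrow> peiffer X m (m' \<otimes>\<^bsub>grpM X\<^esub> m'') =
          peiffer X m m' \<otimes>\<^bsub>grpL X\<^esub>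
          actML X (m \<otimes>\<^bsub>grpM X\<^esub> m' \<otimes>\<^bsub>grpM X\<^esub> inv\<^bsub>grpM X\<^esub> m) (peiffer X m m'')"
    and peiffer_bd2_sym:
      "\<lbrakk>m \<in> carrier (grpM X); l \<in> carrier (grpL X)\<rbrakk>
        \<Longrightarrow> peiffer X m (bd2 X l) \<otimes>\<^bsub>grpL X\<^esub> peiffer X (bd2 X l) m =
          actL X (bd1 X m) l \<otimes>\<^bsub>grpL X\<^esub> inv\<^bsub>grpL X\<^esub> l"
    and peiffer_equivariant:
      "\<lbrakk>n \<in> carrier (grpN X); m \<in> carrier (grpM X); m' \<in> carrier (grpM X)\<rbrakk>
        \<Longrightarrow> actL X n (peiffer X m m') = peiffer X (actM X n m) (actM X n m')"

definition semidirect_LMN :: "('l, 'm, 'n) two_crossed_data \<Rightarrow> ('l \<times> 'm \<times> 'n) monoid" where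
  "semidirect_LMN X =
    \<lparr>carrier = carrier (grpL X) \<times> carrier (grpM X) \<times> carrier (grpN X),
     mult = (\<lambda>(l, m, n) (l', m', n').
       (l \<otimes>\<^bsub>grpL X\<^esub> actML X m (actL X n l'), m \<otimes>\<^bsub>grpM X\<^esub> actM X n m', n \<otimes>\<^bsub>grpN X\<^esub> n')),
     one = (\<one>\<^bsub>grpL X\<^esub>, \<one>\<^bsub>grpM X\<^esub>, \<one>\<^bsub>grpN X\<^esub>)\<rparr>"

definition semidirect_MN :: "('l, 'm, 'n) two_crossed_data \<Rightarrow> ('l \<times> 'm \<times> 'n) monoid" where
  "semidirect_MN X = semidirect_LMN X
    \<lparr>carrier := {\<one>\<^bsub>grpL X\<^esub>} \<times> carrier (grpM X) \<times> carrier (grpN X)\<rparr>"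

definition semidirect_N :: "('l, 'm, 'n) two_crossed_data \<Rightarrow> ('l \<times> 'm \<times> 'n) monoid" where
  "semidirect_N X = semidirect_LMN X
    \<lparr>carrier := {\<one>\<^bsub>grpL X\<^esub>} \<times> {\<one>\<^bsub>grpM X\<^esub>} \<times> carrier (grpN X)\<rparr>"


section \<open>Associative algebras\<close>

text \<open>The library locale \<^locale>\<open>algebra\<close> is restricted to commutative algebras.\<close>

locale assoc_algebra = field K + module K A + ring A
  for K (structure) and A (structure) +
  assumes smult_mult_left:
      "\<lbrakk>c \<in> carrier K; x \<in> carrier A; y \<in> carrier A\<rbrakk>
        \<Longrightarrow> (c \<odot>\<^bsub>A\<^esub> x) \<otimes>\<^bsub>A\<^esub> y = c \<odot>\<^bsub>A\<^esub> (x \<otimes>\<^bsub>A\<^esub> y)"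
    and smult_mult_right:
      "\<lbrakk>c \<in> carrier K; x \<in> carrier A; y \<in> carrier A\<rbrakk>
        \<Longrightarrow> x \<otimes>\<^bsub>A\<^esub> (c \<odot>\<^bsub>A\<^esub> y) = c \<odot>\<^bsub>A\<^esub> (x \<otimes>\<^bsub>A\<^esub> y)"

definition algebra_hom ::
  "('k, 'u) ring_scheme \<Rightarrow> ('k, 'a, 'v) module_scheme \<Rightarrow> ('k, 'b, 'w) module_scheme \<Rightarrow> ('a \<Rightarrow> 'b) set"
  where
  "algebra_hom K A B = {h \<in> ring_hom A B.
    \<forall>c \<in> carrier K. \<forall>x \<in> carrier A. h (c \<odot>\<^bsub>A\<^esub> x) = c \<odot>\<^bsub>B\<^esub> h x}"

definition quotient_algebra :: "('k, 'a, 'v) module_scheme \<Rightarrow> 'a set \<Rightarrow> ('k, 'a set) module" where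
  "quotient_algebra A J =
    \<lparr>carrier = carrier (A Quot J), mult = mult (A Quot J), one = one (A Quot J),
     zero = zero (A Quot J), add = add (A Quot J),
     smult = (\<lambda>c C. \<Union>x\<in>C. J +>\<^bsub>A\<^esub> (c \<odot>\<^bsub>A\<^esub> x))\<rparr>"

text \<open>The map induced on cosets by a map that is constant on each coset.\<close>

definition coset_map :: "('a \<Rightarrow> 'b) \<Rightarrow> 'a set \<Rightarrow> 'b" where
  "coset_map h C = the_elem (h ` C)"

locale pre_cat1_algebra =
  fixes K :: "('k, 'u) ring_scheme"
    and A1 :: "('k, 'a, 'v) module_scheme"
    and A0 :: "('k, 'b, 'w) module_scheme"
    and \<sigma> \<tau> :: "'a \<Rightarrow> 'b"
    and \<iota> :: "'b \<Rightarrow> 'a"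
  assumes algebra_A1: "assoc_algebra K A1"
    and algebra_A0: "assoc_algebra K A0"
    and sigma_hom: "\<sigma> \<in> algebra_hom K A1 A0"
    and tau_hom: "\<tau> \<in> algebra_hom K A1 A0"
    and iota_hom: "\<iota> \<in> algebra_hom K A0 A1"
    and sigma_iota: "x \<in> carrier A0 \<Longrightarrow> \<sigma> (\<iota> x) = x"
    and tau_iota: "x \<in> carrier A0 \<Longrightarrow> \<tau> (\<iota> x) = x"

locale cat1_algebra = pre_cat1_algebra +
  assumes kernel_sigma_tau: "a_kernel A1 A0 \<sigma> \<cdot>\<^bsub>A1\<^esub> a_kernel A1 A0 \<tau> = {\<zero>\<^bsub>A1\<^esub>}"
    and kernel_tau_sigma: "a_kernel A1 A0 \<tau> \<cdot>\<^bsub>A1\<^esub> a_kernel A1 A0 \<sigma> = {\<zero>\<^bsub>A1\<^esub>}"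


section \<open>Group algebras\<close>

definition supp :: "('k, 'u) ring_scheme \<Rightarrow> ('g \<Rightarrow> 'k) \<Rightarrow> 'g set" where
  "supp K f = {g. f g \<noteq> \<zero>\<^bsub>K\<^esub>}"

definition basis_elt :: "('k, 'u) ring_scheme \<Rightarrow> 'g \<Rightarrow> 'g \<Rightarrow> 'k" where
  "basis_elt K g = (\<lambda>x. if x = g then \<one>\<^bsub>K\<^esub> else \<zero>\<^bsub>K\<^esub>)"

text \<open>Elements are finitely supported functions vanishing off the carrier, so that the algebra of a
  subgroup is literally a subset of the algebra of the whole group.\<close>

definition group_algebra ::
  "('k, 'u) ring_scheme \<Rightarrow> ('g, 'v) monoid_scheme \<Rightarrow> ('k, 'g \<Rightarrow> 'k) module" where
  "group_algebra K G =
    \<lparr>carrier = {f. range f \<subseteq> carrier K \<and> finite (supp K f) \<and> supp K f \<subseteq> carrier G},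
     mult = (\<lambda>f f' x. \<Oplus>\<^bsub>K\<^esub>p \<in> {(g, h) \<in> supp K f \<times> supp K f'. g \<otimes>\<^bsub>G\<^esub> h = x}.
       f (fst p) \<otimes>\<^bsub>K\<^esub> f' (snd p)),
     one = basis_elt K \<one>\<^bsub>G\<^esub>,
     zero = (\<lambda>x. \<zero>\<^bsub>K\<^esub>),
     add = (\<lambda>f f' x. f x \<oplus>\<^bsub>K\<^esub> f' x),
     smult = (\<lambda>c f x. c \<otimes>\<^bsub>K\<^esub> f x)\<rparr>"

text \<open>The \<open>K\<close>-linear extension of \<open>e\<^sub>g \<mapsto> e\<^bsub>\<phi> g\<^esub>\<close>.\<close>

definition linear_ext ::
  "('k, 'u) ring_scheme \<Rightarrow> ('g \<Rightarrow> 'h) \<Rightarrow> ('g \<Rightarrow> 'k) \<Rightarrow> 'h \<Rightarrow> 'k" where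
  "linear_ext K \<phi> f = (\<lambda>y. \<Oplus>\<^bsub>K\<^esub>g \<in> {g \<in> supp K f. \<phi> g = y}. f g)"


section \<open>The algebras and maps attached to a 2-crossed module\<close>

definition alg_LMN ::
  "('k, 'u) ring_scheme \<Rightarrow> ('l, 'm, 'n) two_crossed_data \<Rightarrow> ('k, ('l \<times> 'm \<times> 'n) \<Rightarrow> 'k) module" where
  "alg_LMN K X = group_algebra K (semidirect_LMN X)"

definition alg_MN ::
  "('k, 'u) ring_scheme \<Rightarrow> ('l, 'm, 'n) two_crossed_data \<Rightarrow> ('k, ('l \<times> 'm \<times> 'n) \<Rightarrow> 'k) module" where
  "alg_MN K X = group_algebra K (semidirect_MN X)"

definition alg_N ::
  "('k, 'u) ring_scheme \<Rightarrow> ('l, 'm, 'n) two_crossed_data \<Rightarrow> ('k, ('l \<times> 'm \<times> 'n) \<Rightarrow> 'k) module" where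
  "alg_N K X = group_algebra K (semidirect_N X)"

definition four_term ::
  "('k, 'u) ring_scheme \<Rightarrow> ('k, 'g \<Rightarrow> 'k, 'v) module_scheme \<Rightarrow> 'g \<Rightarrow> 'g \<Rightarrow> 'g \<Rightarrow> 'g \<Rightarrow> 'g \<Rightarrow> 'k" where
  "four_term K A a b c d =
    basis_elt K a \<ominus>\<^bsub>A\<^esub> basis_elt K b \<ominus>\<^bsub>A\<^esub> basis_elt K c \<oplus>\<^bsub>A\<^esub> basis_elt K d"

definition J1 ::
  "('k, 'u) ring_scheme \<Rightarrow> ('l, 'm, 'n) two_crossed_data \<Rightarrow> (('l \<times> 'm \<times> 'n) \<Rightarrow> 'k) set" where
  "J1 K X = Idl\<^bsub>alg_MN K X\<^esub>
    {four_term K (alg_MN K X)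
       (\<one>\<^bsub>grpL X\<^esub>, m' \<otimes>\<^bsub>grpM X\<^esub> m, n)
       (\<one>\<^bsub>grpL X\<^esub>, m, n)
       (\<one>\<^bsub>grpL X\<^esub>, m', bd1 X m \<otimes>\<^bsub>grpN X\<^esub> n)
       (\<one>\<^bsub>grpL X\<^esub>, \<one>\<^bsub>grpM X\<^esub>, bd1 X m \<otimes>\<^bsub>grpN X\<^esub> n)
     | m m' n. m \<in> carrier (grpM X) \<and> m' \<in> carrier (grpM X) \<and> n \<in> carrier (grpN X)}"

definition J2 ::
  "('k, 'u) ring_scheme \<Rightarrow> ('l, 'm, 'n) two_crossed_data \<Rightarrow> (('l \<times> 'm \<times> 'n) \<Rightarrow> 'k) set" where
  "J2 K X = Idl\<^bsub>alg_LMN K X\<^esub>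
    ({four_term K (alg_LMN K X)
       (l' \<otimes>\<^bsub>grpL X\<^esub> l, m, n)
       (l, m, n)
       (l', bd2 X l \<otimes>\<^bsub>grpM X\<^esub> m, n)
       (\<one>\<^bsub>grpL X\<^esub>, bd2 X l \<otimes>\<^bsub>grpM X\<^esub> m, n)
      | l l' m n. l \<in> carrier (grpL X) \<and> l' \<in> carrier (grpL X) \<and>
          m \<in> carrier (grpM X) \<and> n \<in> carrier (grpN X)} \<union>
     {four_term K (alg_LMN K X)
       (l' \<otimes>\<^bsub>grpL X\<^esub> actML X m' l, m' \<otimes>\<^bsub>grpM X\<^esub> m, n)
       (l, m, n)
       (l', m', bd1 X m \<otimes>\<^bsub>grpN X\<^esub> n)
       (\<one>\<^bsub>grpL X\<^esub>, \<one>\<^bsub>grpM X\<^esub>, bd1 X m \<otimes>\<^bsub>grpN X\<^esub> n)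
      | l l' m m' n. l \<in> carrier (grpL X) \<and> l' \<in> carrier (grpL X) \<and>
          m \<in> carrier (grpM X) \<and> m' \<in> carrier (grpM X) \<and> n \<in> carrier (grpN X)} \<union>
     {four_term K (alg_LMN K X)
       (\<one>\<^bsub>grpL X\<^esub>, m' \<otimes>\<^bsub>grpM X\<^esub> m, n)
       (\<one>\<^bsub>grpL X\<^esub>, m, n)
       (\<one>\<^bsub>grpL X\<^esub>, m', bd1 X m \<otimes>\<^bsub>grpN X\<^esub> n)
       (\<one>\<^bsub>grpL X\<^esub>, \<one>\<^bsub>grpM X\<^esub>, bd1 X m \<otimes>\<^bsub>grpN X\<^esub> n)
      | m m' n. m \<in> carrier (grpM X) \<and> m' \<in> carrier (grpM X) \<and> n \<in> carrier (grpN X)})"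

definition bar_LMN ::
  "('k, 'u) ring_scheme \<Rightarrow> ('l, 'm, 'n) two_crossed_data \<Rightarrow> ('k, (('l \<times> 'm \<times> 'n) \<Rightarrow> 'k) set) module" where
  "bar_LMN K X = quotient_algebra (alg_LMN K X) (J2 K X)"

definition bar_MN ::
  "('k, 'u) ring_scheme \<Rightarrow> ('l, 'm, 'n) two_crossed_data \<Rightarrow> ('k, (('l \<times> 'm \<times> 'n) \<Rightarrow> 'k) set) module" where
  "bar_MN K X = quotient_algebra (alg_MN K X) (J1 K X)"

definition sigma3_bar ::
  "('k, 'u) ring_scheme \<Rightarrow> ('l, 'm, 'n) two_crossed_data \<Rightarrow>
    (('l \<times> 'm \<times> 'n) \<Rightarrow> 'k) set \<Rightarrow> (('l \<times> 'm \<times> 'n) \<Rightarrow> 'k) set" where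
  "sigma3_bar K X = coset_map (\<lambda>x. J1 K X +>\<^bsub>alg_MN K X\<^esub>
    linear_ext K (\<lambda>(l, m, n). (\<one>\<^bsub>grpL X\<^esub>, m, n)) x)"

definition tau3_bar ::
  "('k, 'u) ring_scheme \<Rightarrow> ('l, 'm, 'n) two_crossed_data \<Rightarrow>
    (('l \<times> 'm \<times> 'n) \<Rightarrow> 'k) set \<Rightarrow> (('l \<times> 'm \<times> 'n) \<Rightarrow> 'k) set" where
  "tau3_bar K X = coset_map (\<lambda>x. J1 K X +>\<^bsub>alg_MN K X\<^esub>
    linear_ext K (\<lambda>(l, m, n). (\<one>\<^bsub>grpL X\<^esub>, bd2 X l \<otimes>\<^bsub>grpM X\<^esub> m, n)) x)"

definition iota3_bar ::
  "('k, 'u) ring_scheme \<Rightarrow> ('l, 'm, 'n) two_crossed_data \<Rightarrow>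
    (('l \<times> 'm \<times> 'n) \<Rightarrow> 'k) set \<Rightarrow> (('l \<times> 'm \<times> 'n) \<Rightarrow> 'k) set" where
  "iota3_bar K X = coset_map (\<lambda>x. J2 K X +>\<^bsub>alg_LMN K X\<^esub> x)"

definition sigma2_bar ::
  "('k, 'u) ring_scheme \<Rightarrow> ('l, 'm, 'n) two_crossed_data \<Rightarrow>
    (('l \<times> 'm \<times> 'n) \<Rightarrow> 'k) set \<Rightarrow> ('l \<times> 'm \<times> 'n) \<Rightarrow> 'k" where
  "sigma2_bar K X = coset_map
    (linear_ext K (\<lambda>(l, m, n). (\<one>\<^bsub>grpL X\<^esub>, \<one>\<^bsub>grpM X\<^esub>, n)))"

definition tau2_bar ::
  "('k, 'u) ring_scheme \<Rightarrow> ('l, 'm, 'n) two_crossed_data \<Rightarrow>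
    (('l \<times> 'm \<times> 'n) \<Rightarrow> 'k) set \<Rightarrow> ('l \<times> 'm \<times> 'n) \<Rightarrow> 'k" where
  "tau2_bar K X = coset_map
    (linear_ext K (\<lambda>(l, m, n). (\<one>\<^bsub>grpL X\<^esub>, \<one>\<^bsub>grpM X\<^esub>, bd1 X m \<otimes>\<^bsub>grpN X\<^esub> n)))"

definition iota2_bar ::
  "('k, 'u) ring_scheme \<Rightarrow> ('l, 'm, 'n) two_crossed_data \<Rightarrow>
    (('l \<times> 'm \<times> 'n) \<Rightarrow> 'k) \<Rightarrow> (('l \<times> 'm \<times> 'n) \<Rightarrow> 'k) set" where
  "iota2_bar K X = (\<lambda>x. J1 K X +>\<^bsub>alg_MN K X\<^esub> x)"

definition bar_elt_LMN ::
  "('k, 'u) ring_scheme \<Rightarrow> ('l, 'm, 'n) two_crossed_data \<Rightarrow> ('l \<times> 'm \<times> 'n) \<Rightarrow>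
    (('l \<times> 'm \<times> 'n) \<Rightarrow> 'k) set" where
  "bar_elt_LMN K X g = J2 K X +>\<^bsub>alg_LMN K X\<^esub> basis_elt K g"

definition bar_elt_MN ::
  "('k, 'u) ring_scheme \<Rightarrow> ('l, 'm, 'n) two_crossed_data \<Rightarrow> ('l \<times> 'm \<times> 'n) \<Rightarrow>
    (('l \<times> 'm \<times> 'n) \<Rightarrow> 'k) set" where
  "bar_elt_MN K X g = J1 K X +>\<^bsub>alg_MN K X\<^esub> basis_elt K g"

end

theory Submission
  imports Defs
begin

text \<open>
  The proof first checks that the semidirect product \<open>G\<^sub>3 = L \<rtimes> M \<rtimes> N\<close> really is a group. The only
  point that is not formal is that the derived formula \<open>\<^sup>ml = {\<partial>\<^sub>2l, m} l\<close> defines an action of \<open>M\<close> on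
  \<open>L\<close> by automorphisms (\<open>actML_mult\<close>, \<open>actML_compose\<close>). Both laws come from one identity
  (\<open>peiffer_bd2_mult\<close>), which says that an element \<open>\<partial>\<^sub>2c\<close> acts by conjugation with \<open>c\<close>, and
  more precisely that \<open>\<^bsup>\<partial>\<^sub>2c m\<^esup>l = c (\<^sup>ml) c\<^sup>-\<^sup>1\<close>.

  The maps \<open>(l, m, n) \<mapsto> (1, m, n)\<close>, \<open>(1, \<partial>\<^sub>2l m, n)\<close> on \<open>G\<^sub>3\<close> and \<open>(1, m, n) \<mapsto> (1, 1, n)\<close>,
  \<open>(1, 1, \<partial>\<^sub>1m n)\<close> on \<open>1 \<rtimes> M \<rtimes> N\<close> are group homomorphisms that restrict to the identity on the
  smaller subgroup, so their linear extensions are split algebra homomorphisms. They send every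
  generator of \<open>J\<^sub>2\<close> either to a four-term sum that cancels or to a generator of \<open>J\<^sub>1\<close>, and every
  generator of \<open>J\<^sub>1\<close> to a sum that cancels. Hence they descend to the quotients, which gives both
  pre-cat\<open>\<^sup>1\<close>-algebras.

  For the kernel condition write \<open>s\<close> and \<open>t\<close> for the linear extensions of the first two maps. An
  element of \<open>Ker \<sigma>\<close> is represented by some \<open>x\<close> with \<open>s x \<in> J\<^sub>1 \<subseteq> J\<^sub>2\<close>, hence also by \<open>x - s x\<close>
  (\<open>kernel_representative\<close>), and likewise for \<open>t\<close>. So it suffices that
  \<open>(x - s x)(y - t y)\<close> and \<open>(x - t x)(y - s y)\<close> lie in \<open>J\<^sub>2\<close>. By bilinearity
  (\<open>defect_product_in_ideal\<close>) this is needed only for group elements, where each product is, up to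
  the order of its two middle terms, one of the first generators
  \<open>e(l'l, m, n) - e(l, m, n) - e(l', \<partial>\<^sub>2l m, n) + e(1, \<partial>\<^sub>2l m, n)\<close> of \<open>J\<^sub>2\<close> (\<open>defect_products\<close>).
\<close>

section \<open>The derived action and the semidirect product\<close>

lemma (in group) mult_inv_cancel:
  assumes "x \<in> carrier G" "y \<in> carrier G"
  shows "x \<otimes> (inv x \<otimes> y) = y" "inv x \<otimes> (x \<otimes> y) = y"
  using assms by (simp_all flip: m_assoc)

lemma hom_AutoGroup_action:
  assumes act: "a \<in> hom N (AutoGroup G)" and grp: "group N" "group G"
  shows action_closed: "\<And>n x. \<lbrakk>n \<in> carrier N; x \<in> carrier G\<rbrakk> \<Longrightarrow> a n x \<in> carrier G"
    and action_mult: "\<And>n x y. \<lbrakk>n \<in> carrier N; x \<in> carrier G; y \<in> carrier G\<rbrakk>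
      \<Longrightarrow> a n (x \<otimes>\<^bsub>G\<^esub> y) = a n x \<otimes>\<^bsub>G\<^esub> a n y"
    and action_compose: "\<And>n n' x. \<lbrakk>n \<in> carrier N; n' \<in> carrier N; x \<in> carrier G\<rbrakk>
      \<Longrightarrow> a (n \<otimes>\<^bsub>N\<^esub> n') x = a n (a n' x)"
    and action_one: "\<And>x. x \<in> carrier G \<Longrightarrow> a \<one>\<^bsub>N\<^esub> x = x"
    and action_unit: "\<And>n. n \<in> carrier N \<Longrightarrow> a n \<one>\<^bsub>G\<^esub> = \<one>\<^bsub>G\<^esub>"
proof -
  interpret N: group N by fact
  interpret G: group G by fact
  have auto: "a n \<in> hom G G" "a n \<in> Bij (carrier G)" if "n \<in> carrier N" for n
    using hom_in_carrier[OF act that] by (auto simp: AutoGroup_def auto_def)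
  show "a n x \<in> carrier G" if "n \<in> carrier N" "x \<in> carrier G" for n x
    using auto(1) that by (auto intro: hom_in_carrier)
  show "a n (x \<otimes>\<^bsub>G\<^esub> y) = a n x \<otimes>\<^bsub>G\<^esub> a n y"
    if "n \<in> carrier N" "x \<in> carrier G" "y \<in> carrier G" for n x y
    using auto(1) that by (auto intro: hom_mult)
  show "a (n \<otimes>\<^bsub>N\<^esub> n') x = a n (a n' x)"
    if "n \<in> carrier N" "n' \<in> carrier N" "x \<in> carrier G" for n n' x
    using hom_mult[OF act that(1,2)] auto(2) that
    by (simp add: AutoGroup_def BijGroup_def compose_def)
  show "a \<one>\<^bsub>N\<^esub> x = x" if "x \<in> carrier G" for x
    using hom_one[OF act grp(1) G.AutoGroup] that by (simp add: AutoGroup_def BijGroup_def)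
  show "a n \<one>\<^bsub>G\<^esub> = \<one>\<^bsub>G\<^esub>" if "n \<in> carrier N" for n
    using hom_one[OF auto(1)[OF that] grp(2,2)] .
qed

sublocale two_crossed_module \<subseteq> L: group "grpL X" by (rule group_L)
sublocale two_crossed_module \<subseteq> M: group "grpM X" by (rule group_M)
sublocale two_crossed_module \<subseteq> N: group "grpN X" by (rule group_N)

context two_crossed_module
begin

abbreviation "L \<equiv> grpL X"
abbreviation "M \<equiv> grpM X"
abbreviation "N \<equiv> grpN X"
abbreviation "d2 \<equiv> bd2 X"
abbreviation "d1 \<equiv> bd1 X"

lemmas actM_simps [simp] =
  action_closed[OF actM_hom group_N group_M] action_mult[OF actM_hom group_N group_M]
  action_one[OF actM_hom group_N group_M] action_unit[OF actM_hom group_N group_M]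
lemmas actL_simps [simp] =
  action_closed[OF actL_hom group_N group_L] action_mult[OF actL_hom group_N group_L]
  action_one[OF actL_hom group_N group_L] action_unit[OF actL_hom group_N group_L]
lemmas actM_compose = action_compose[OF actM_hom group_N group_M]
lemmas actL_compose = action_compose[OF actL_hom group_N group_L]

lemma bd2_simps [simp]:
  "l \<in> carrier L \<Longrightarrow> d2 l \<in> carrier M"
  "\<lbrakk>l \<in> carrier L; l' \<in> carrier L\<rbrakk> \<Longrightarrow> d2 (l \<otimes>\<^bsub>L\<^esub> l') = d2 l \<otimes>\<^bsub>M\<^esub> d2 l'"
  "d2 \<one>\<^bsub>L\<^esub> = \<one>\<^bsub>M\<^esub>"
  "l \<in> carrier L \<Longrightarrow> d2 (inv\<^bsub>L\<^esub> l) = inv\<^bsub>M\<^esub> (d2 l)"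
  using bd2_hom hom_one[OF bd2_hom group_L group_M]
    group_hom.hom_inv[of L M d2] by (auto simp: hom_def group_hom_def group_hom_axioms_def)

lemma bd1_simps [simp]:
  "m \<in> carrier M \<Longrightarrow> d1 m \<in> carrier N"
  "\<lbrakk>m \<in> carrier M; m' \<in> carrier M\<rbrakk> \<Longrightarrow> d1 (m \<otimes>\<^bsub>M\<^esub> m') = d1 m \<otimes>\<^bsub>N\<^esub> d1 m'"
  "d1 \<one>\<^bsub>M\<^esub> = \<one>\<^bsub>N\<^esub>"
  using bd1_hom hom_one[OF bd1_hom group_M group_N] by (auto simp: hom_def)

lemma actML_closed [simp]:
  "\<lbrakk>m \<in> carrier M; l \<in> carrier L\<rbrakk> \<Longrightarrow> actML X m l \<in> carrier L"
  by (simp add: actML_def peiffer_closed)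

text \<open>With the next lemma this says that \<open>\<partial>\<^sub>2\<close> obeys the two crossed-module laws for the derived action.\<close>

lemma bd2_actML:
  assumes "m \<in> carrier M" "l \<in> carrier L"
  shows "d2 (actML X m l) = m \<otimes>\<^bsub>M\<^esub> d2 l \<otimes>\<^bsub>M\<^esub> inv\<^bsub>M\<^esub> m"
  using assms by (simp add: actML_def bd2_peiffer peiffer_closed complex M.m_assoc)

lemma actML_bd2:
  assumes "a \<in> carrier L" "b \<in> carrier L"
  shows "actML X (d2 a) b = a \<otimes>\<^bsub>L\<^esub> b \<otimes>\<^bsub>L\<^esub> inv\<^bsub>L\<^esub> a"
  using assms by (simp add: actML_def peiffer_bd2_bd2 L.m_assoc)

lemma peiffer_one_right [simp]:
  assumes "m \<in> carrier M" shows "peiffer X m \<one>\<^bsub>M\<^esub> = \<one>\<^bsub>L\<^esub>"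
proof -
  have one_one: "peiffer X \<one>\<^bsub>M\<^esub> \<one>\<^bsub>M\<^esub> = \<one>\<^bsub>L\<^esub>"
    using peiffer_mult_left[of "\<one>\<^bsub>M\<^esub>" "\<one>\<^bsub>M\<^esub>" "\<one>\<^bsub>M\<^esub>"] peiffer_closed[of "\<one>\<^bsub>M\<^esub>" "\<one>\<^bsub>M\<^esub>"]
    by simp
  have "d2 (peiffer X m \<one>\<^bsub>M\<^esub>) = \<one>\<^bsub>M\<^esub>"
    using assms by (simp add: bd2_peiffer)
  then have "actML X (m \<otimes>\<^bsub>M\<^esub> \<one>\<^bsub>M\<^esub> \<otimes>\<^bsub>M\<^esub> inv\<^bsub>M\<^esub> m) (peiffer X m \<one>\<^bsub>M\<^esub>) = peiffer X m \<one>\<^bsub>M\<^esub>"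
    using assms one_one peiffer_closed[of m "\<one>\<^bsub>M\<^esub>"] by (simp add: actML_def)
  then show ?thesis
    using peiffer_mult_right[of m "\<one>\<^bsub>M\<^esub>" "\<one>\<^bsub>M\<^esub>"] peiffer_closed[of m "\<one>\<^bsub>M\<^esub>"] assms by simp
qed

lemma actML_one [simp]: "l \<in> carrier L \<Longrightarrow> actML X \<one>\<^bsub>M\<^esub> l = l"
  by (simp add: actML_def)

text \<open>Expanding the lifting in its second argument makes \<open>\<partial>\<^sub>2(x c x\<^sup>-\<^sup>1)\<close> act on \<open>{\<partial>\<^sub>2x, m}\<close>; that action is
  a conjugation, and the commutator \<open>{\<partial>\<^sub>2x, \<partial>\<^sub>2c} = [c, x]\<close> cancels most of it.\<close>

lemma peiffer_bd2_mult:
  assumes "x \<in> carrier L" "c \<in> carrier L" "m \<in> carrier M"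
  shows "peiffer X (d2 x) (d2 c \<otimes>\<^bsub>M\<^esub> m) =
    c \<otimes>\<^bsub>L\<^esub> peiffer X (d2 x) m \<otimes>\<^bsub>L\<^esub> x \<otimes>\<^bsub>L\<^esub> inv\<^bsub>L\<^esub> c \<otimes>\<^bsub>L\<^esub> inv\<^bsub>L\<^esub> x"
proof -
  have eq: "d2 x \<otimes>\<^bsub>M\<^esub> d2 c \<otimes>\<^bsub>M\<^esub> inv\<^bsub>M\<^esub> (d2 x) = d2 (x \<otimes>\<^bsub>L\<^esub> c \<otimes>\<^bsub>L\<^esub> inv\<^bsub>L\<^esub> x)"
    using assms by simp
  have p: "peiffer X (d2 x) m \<in> carrier L"
    using assms by (simp add: peiffer_closed)
  have "peiffer X (d2 x) (d2 c \<otimes>\<^bsub>M\<^esub> m) = peiffer X (d2 x) (d2 c) \<otimes>\<^bsub>L\<^esub>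
      actML X (d2 (x \<otimes>\<^bsub>L\<^esub> c \<otimes>\<^bsub>L\<^esub> inv\<^bsub>L\<^esub> x)) (peiffer X (d2 x) m)"
    using peiffer_mult_right[of "d2 x" "d2 c" m] assms unfolding eq by (simp del: bd2_simps(2,4))
  also have "\<dots> = c \<otimes>\<^bsub>L\<^esub> x \<otimes>\<^bsub>L\<^esub> inv\<^bsub>L\<^esub> c \<otimes>\<^bsub>L\<^esub> inv\<^bsub>L\<^esub> x \<otimes>\<^bsub>L\<^esub> (x \<otimes>\<^bsub>L\<^esub> c \<otimes>\<^bsub>L\<^esub> inv\<^bsub>L\<^esub> x \<otimes>\<^bsub>L\<^esub>
      peiffer X (d2 x) m \<otimes>\<^bsub>L\<^esub> inv\<^bsub>L\<^esub> (x \<otimes>\<^bsub>L\<^esub> c \<otimes>\<^bsub>L\<^esub> inv\<^bsub>L\<^esub> x))"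
    using assms p by (subst actML_bd2) (auto simp: peiffer_bd2_bd2)
  also have "\<dots> = c \<otimes>\<^bsub>L\<^esub> peiffer X (d2 x) m \<otimes>\<^bsub>L\<^esub> x \<otimes>\<^bsub>L\<^esub> inv\<^bsub>L\<^esub> c \<otimes>\<^bsub>L\<^esub> inv\<^bsub>L\<^esub> x"
    using assms p by (simp add: L.m_assoc L.inv_mult_group L.mult_inv_cancel)
  finally show ?thesis .
qed

text \<open>This composition law for \<open>\<partial>\<^sub>2c\<close> and \<open>m\<close> has to come before the general one, whose proof uses it.\<close>

lemma actML_bd2_mult:
  assumes "x \<in> carrier L" "c \<in> carrier L" "m \<in> carrier M"
  shows "actML X (d2 c \<otimes>\<^bsub>M\<^esub> m) x = c \<otimes>\<^bsub>L\<^esub> actML X m x \<otimes>\<^bsub>L\<^esub> inv\<^bsub>L\<^esub> c"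
  using assms by (simp add: actML_def peiffer_bd2_mult peiffer_closed L.m_assoc)

text \<open>The left expansion of the lifting produces \<open>\<partial>\<^sub>2l' m \<partial>\<^sub>2l'\<^sup>-\<^sup>1\<close> in place of \<open>m\<close>. The boundary of
  \<open>{\<partial>\<^sub>2l', m}\<close> is \<open>m \<partial>\<^sub>2l' m\<^sup>-\<^sup>1 \<partial>\<^sub>2l'\<^sup>-\<^sup>1\<close>, so this element is \<open>\<partial>\<^sub>2c m\<close> with
  \<open>c = {\<partial>\<^sub>2l', m}\<^sup>-\<^sup>1\<close>, and the twist is undone by conjugation with \<open>c\<close>.\<close>

lemma actML_mult:
  assumes "m \<in> carrier M" "l \<in> carrier L" "l' \<in> carrier L"
  shows "actML X m (l \<otimes>\<^bsub>L\<^esub> l') = actML X m l \<otimes>\<^bsub>L\<^esub> actML X m l'"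
proof -
  define c where "c = inv\<^bsub>L\<^esub> (peiffer X (d2 l') m)"
  have p: "peiffer X (d2 l') m \<in> carrier L" "peiffer X (d2 l) m \<in> carrier L" "c \<in> carrier L"
    using assms by (simp_all add: peiffer_closed c_def)
  have "d2 l' \<otimes>\<^bsub>M\<^esub> m \<otimes>\<^bsub>M\<^esub> inv\<^bsub>M\<^esub> (d2 l') = d2 c \<otimes>\<^bsub>M\<^esub> m"
    using assms p by (simp add: c_def bd2_peiffer complex M.inv_mult_group M.m_assoc)
  then have "peiffer X (d2 l \<otimes>\<^bsub>M\<^esub> d2 l') m = peiffer X (d2 l') m \<otimes>\<^bsub>L\<^esub> peiffer X (d2 l) (d2 c \<otimes>\<^bsub>M\<^esub> m)"
    using assms p peiffer_mult_left[of "d2 l" "d2 l'" m] by (simp add: complex)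
  then show ?thesis
    using assms p by (simp add: actML_def peiffer_bd2_mult) (simp add: c_def L.m_assoc L.mult_inv_cancel)
qed

text \<open>The same substitution, now applied to the right expansion of the lifting.\<close>

lemma actML_compose:
  assumes "m \<in> carrier M" "m' \<in> carrier M" "l \<in> carrier L"
  shows "actML X (m \<otimes>\<^bsub>M\<^esub> m') l = actML X m (actML X m' l)"
proof -
  define c where "c = inv\<^bsub>L\<^esub> (peiffer X (d2 l) m)"
  have p: "peiffer X (d2 l) m \<in> carrier L" "peiffer X (d2 l) m' \<in> carrier L" "c \<in> carrier L"
    using assms by (simp_all add: peiffer_closed c_def)
  have "d2 l \<otimes>\<^bsub>M\<^esub> m \<otimes>\<^bsub>M\<^esub> inv\<^bsub>M\<^esub> (d2 l) = d2 c \<otimes>\<^bsub>M\<^esub> m"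
    using assms p by (simp add: c_def bd2_peiffer complex M.inv_mult_group M.m_assoc)
  then have "peiffer X (d2 l) (m \<otimes>\<^bsub>M\<^esub> m') = peiffer X (d2 l) m \<otimes>\<^bsub>L\<^esub> actML X (d2 c \<otimes>\<^bsub>M\<^esub> m) (peiffer X (d2 l) m')"
    using assms peiffer_mult_right[of "d2 l" m m'] by simp
  then have "actML X (m \<otimes>\<^bsub>M\<^esub> m') l = peiffer X (d2 l) m \<otimes>\<^bsub>L\<^esub>
      (c \<otimes>\<^bsub>L\<^esub> actML X m (peiffer X (d2 l) m') \<otimes>\<^bsub>L\<^esub> inv\<^bsub>L\<^esub> c) \<otimes>\<^bsub>L\<^esub> l"
    using assms p by (simp add: actML_def[of X "m \<otimes>\<^bsub>M\<^esub> m'"] actML_bd2_mult)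
  also have "\<dots> = actML X m (peiffer X (d2 l) m') \<otimes>\<^bsub>L\<^esub> actML X m l"
    using assms p by (simp add: c_def actML_def[of X m l] L.m_assoc L.mult_inv_cancel)
  also have "\<dots> = actML X m (actML X m' l)"
    using assms p by (simp add: actML_def[of X m' l] actML_mult)
  finally show ?thesis .
qed

lemma actL_actML:
  assumes "n \<in> carrier N" "m \<in> carrier M" "l \<in> carrier L"
  shows "actL X n (actML X m l) = actML X (actM X n m) (actL X n l)"
  using assms by (simp add: actML_def peiffer_closed peiffer_equivariant bd2_equivariant)

lemma actML_unit [simp]: "m \<in> carrier M \<Longrightarrow> actML X m \<one>\<^bsub>L\<^esub> = \<one>\<^bsub>L\<^esub>"
  using actML_mult[of m "\<one>\<^bsub>L\<^esub>" "\<one>\<^bsub>L\<^esub>"] by simp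

lemma carrier_LMN [simp]:
  "carrier (semidirect_LMN X) = carrier L \<times> carrier M \<times> carrier N"
  by (simp add: semidirect_LMN_def)

lemma mult_LMN [simp]:
  "(l, m, n) \<otimes>\<^bsub>semidirect_LMN X\<^esub> (l', m', n') =
    (l \<otimes>\<^bsub>L\<^esub> actML X m (actL X n l'), m \<otimes>\<^bsub>M\<^esub> actM X n m', n \<otimes>\<^bsub>N\<^esub> n')"
  by (simp add: semidirect_LMN_def)

lemma one_LMN [simp]: "\<one>\<^bsub>semidirect_LMN X\<^esub> = (\<one>\<^bsub>L\<^esub>, \<one>\<^bsub>M\<^esub>, \<one>\<^bsub>N\<^esub>)"
  by (simp add: semidirect_LMN_def)

lemma act_left_inverse:
  assumes "n \<in> carrier N" "m \<in> carrier M" "l \<in> carrier L"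
  shows "actM X n (inv\<^bsub>M\<^esub> m) \<otimes>\<^bsub>M\<^esub> actM X n m = \<one>\<^bsub>M\<^esub>"
    and "actL X n (actML X (inv\<^bsub>M\<^esub> m) (inv\<^bsub>L\<^esub> l)) \<otimes>\<^bsub>L\<^esub>
      actML X (actM X n (inv\<^bsub>M\<^esub> m)) (actL X n l) = \<one>\<^bsub>L\<^esub>"
proof -
  show "actM X n (inv\<^bsub>M\<^esub> m) \<otimes>\<^bsub>M\<^esub> actM X n m = \<one>\<^bsub>M\<^esub>"
    using assms actM_simps(2)[of n "inv\<^bsub>M\<^esub> m" m] by (simp del: actM_simps(2))
  have "actL X n (actML X (inv\<^bsub>M\<^esub> m) (inv\<^bsub>L\<^esub> l)) \<otimes>\<^bsub>L\<^esub>
      actML X (actM X n (inv\<^bsub>M\<^esub> m)) (actL X n l) =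
      actL X n (actML X (inv\<^bsub>M\<^esub> m) (inv\<^bsub>L\<^esub> l \<otimes>\<^bsub>L\<^esub> l))"
    using assms by (subst actML_mult) (simp_all add: actL_actML)
  then show "actL X n (actML X (inv\<^bsub>M\<^esub> m) (inv\<^bsub>L\<^esub> l)) \<otimes>\<^bsub>L\<^esub>
      actML X (actM X n (inv\<^bsub>M\<^esub> m)) (actL X n l) = \<one>\<^bsub>L\<^esub>"
    using assms by simp
qed

lemma group_semidirect_LMN: "group (semidirect_LMN X)"
proof (rule groupI)
  fix x assume "x \<in> carrier (semidirect_LMN X)"
  then obtain l m n where x: "x = (l, m, n)" "l \<in> carrier L" "m \<in> carrier M" "n \<in> carrier N"
    by auto
  define y where "y = (actL X (inv\<^bsub>N\<^esub> n) (actML X (inv\<^bsub>M\<^esub> m) (inv\<^bsub>L\<^esub> l)),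
    actM X (inv\<^bsub>N\<^esub> n) (inv\<^bsub>M\<^esub> m), inv\<^bsub>N\<^esub> n)"
  have "y \<otimes>\<^bsub>semidirect_LMN X\<^esub> x = \<one>\<^bsub>semidirect_LMN X\<^esub>"
    using x by (simp add: y_def act_left_inverse)
  then show "\<exists>y\<in>carrier (semidirect_LMN X). y \<otimes>\<^bsub>semidirect_LMN X\<^esub> x = \<one>\<^bsub>semidirect_LMN X\<^esub>"
    using x by (intro bexI[of _ y]) (auto simp: y_def)
qed (auto simp: L.m_assoc M.m_assoc N.m_assoc actML_mult actML_compose actL_actML
    actL_compose actM_compose)

text \<open>Multiplicativity of the two maps with boundary components is where equivariance of the boundaries
  enters; for \<open>\<partial>\<^sub>2\<close> it is combined with \<open>\<partial>\<^sub>2(\<^sup>ml) = m \<partial>\<^sub>2l m\<^sup>-\<^sup>1\<close>.\<close>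

lemma LMN_s3_hom: "(\<lambda>(l, m, n). (\<one>\<^bsub>L\<^esub>, m, n)) \<in> hom (semidirect_LMN X) (semidirect_LMN X)"
    and LMN_t3_hom: "(\<lambda>(l, m, n). (\<one>\<^bsub>L\<^esub>, d2 l \<otimes>\<^bsub>M\<^esub> m, n)) \<in> hom (semidirect_LMN X) (semidirect_LMN X)"
    and LMN_s2_hom: "(\<lambda>(l, m, n). (\<one>\<^bsub>L\<^esub>, \<one>\<^bsub>M\<^esub>, n)) \<in> hom (semidirect_LMN X) (semidirect_LMN X)"
    and LMN_t2_hom: "(\<lambda>(l, m, n). (\<one>\<^bsub>L\<^esub>, \<one>\<^bsub>M\<^esub>, d1 m \<otimes>\<^bsub>N\<^esub> n)) \<in> hom (semidirect_LMN X) (semidirect_LMN X)"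
  by (auto intro!: homI simp: bd2_actML bd2_equivariant bd1_equivariant M.m_assoc N.m_assoc
      M.mult_inv_cancel N.mult_inv_cancel)

text \<open>Being the image of an endomorphism spares a separate computation of inverses; the same applies to
  the innermost factor below.\<close>

lemma subgroup_MN: "subgroup ({\<one>\<^bsub>L\<^esub>} \<times> carrier M \<times> carrier N) (semidirect_LMN X)"
proof -
  interpret group_hom "semidirect_LMN X" "semidirect_LMN X" "\<lambda>(l, m, n). (\<one>\<^bsub>L\<^esub>, m, n)"
    by (intro group_hom.intro group_hom_axioms.intro group_semidirect_LMN LMN_s3_hom)
  have "(\<lambda>(l, m, n). (\<one>\<^bsub>L\<^esub>, m, n)) ` carrier (semidirect_LMN X) = {\<one>\<^bsub>L\<^esub>} \<times> carrier M \<times> carrier N"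
    by (force simp: image_iff)
  then show ?thesis
    using img_is_subgroup by simp
qed

lemma subgroup_N: "subgroup ({\<one>\<^bsub>L\<^esub>} \<times> {\<one>\<^bsub>M\<^esub>} \<times> carrier N) (semidirect_LMN X)"
proof -
  interpret group_hom "semidirect_LMN X" "semidirect_LMN X" "\<lambda>(l, m, n). (\<one>\<^bsub>L\<^esub>, \<one>\<^bsub>M\<^esub>, n)"
    by (intro group_hom.intro group_hom_axioms.intro group_semidirect_LMN LMN_s2_hom)
  have "(\<lambda>(l, m, n). (\<one>\<^bsub>L\<^esub>, \<one>\<^bsub>M\<^esub>, n)) ` carrier (semidirect_LMN X) = {\<one>\<^bsub>L\<^esub>} \<times> {\<one>\<^bsub>M\<^esub>} \<times> carrier N"
    by (force simp: image_iff)
  then show ?thesis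
    using img_is_subgroup by simp
qed

lemma group_semidirect_MN: "group (semidirect_MN X)"
  using subgroup.subgroup_is_group[OF subgroup_MN group_semidirect_LMN] by (simp add: semidirect_MN_def)

lemma group_semidirect_N: "group (semidirect_N X)"
  using subgroup.subgroup_is_group[OF subgroup_N group_semidirect_LMN] by (simp add: semidirect_N_def)

end

section \<open>The group algebra\<close>

context field
begin

lemma linear_ext_eq:
  assumes "\<forall>x. f x \<in> carrier R" "finite A" "supp R f \<subseteq> A"
  shows "linear_ext R \<phi> f y = (\<Oplus>g\<in>A. if \<phi> g = y then f g else \<zero>)"
  unfolding linear_ext_def using assms
  by (intro add.finprod_mono_neutral_cong_left) (auto simp: supp_def)

lemma linear_ext_closed:
  assumes "\<forall>x. f x \<in> carrier R"
  shows "linear_ext R \<phi> f y \<in> carrier R"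
  unfolding linear_ext_def using assms by (intro finsum_closed) auto

lemma linear_ext_add:
  assumes "\<forall>x. f x \<in> carrier R" "finite (supp R f)" "\<forall>x. f' x \<in> carrier R" "finite (supp R f')"
  shows "linear_ext R \<phi> (\<lambda>x. f x \<oplus> f' x) = (\<lambda>y. linear_ext R \<phi> f y \<oplus> linear_ext R \<phi> f' y)"
proof
  fix y
  let ?A = "supp R f \<union> supp R f'"
  have [simp]: "f x \<in> carrier R" "f' x \<in> carrier R" for x
    using assms by auto
  have "supp R (\<lambda>x. f x \<oplus> f' x) \<subseteq> ?A"
    by (auto simp: supp_def)
  then have "linear_ext R \<phi> (\<lambda>x. f x \<oplus> f' x) y =
      (\<Oplus>g\<in>?A. if \<phi> g = y then f g \<oplus> f' g else \<zero>)"
    using assms by (intro linear_ext_eq) auto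
  also have "\<dots> = (\<Oplus>g\<in>?A. (if \<phi> g = y then f g else \<zero>) \<oplus> (if \<phi> g = y then f' g else \<zero>))"
    by (intro finsum_cong') auto
  also have "\<dots> = linear_ext R \<phi> f y \<oplus> linear_ext R \<phi> f' y"
    using assms by (subst finsum_addf) (auto simp: linear_ext_eq[of _ ?A])
  finally show "linear_ext R \<phi> (\<lambda>x. f x \<oplus> f' x) y = linear_ext R \<phi> f y \<oplus> linear_ext R \<phi> f' y" .
qed

lemma linear_ext_smult:
  assumes "c \<in> carrier R" "\<forall>x. f x \<in> carrier R" "finite (supp R f)"
  shows "linear_ext R \<phi> (\<lambda>x. c \<otimes> f x) = (\<lambda>y. c \<otimes> linear_ext R \<phi> f y)"
proof
  fix y
  let ?A = "supp R f"
  have [simp]: "f x \<in> carrier R" for x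
    using assms by auto
  have "supp R (\<lambda>x. c \<otimes> f x) \<subseteq> ?A"
    using assms by (auto simp: supp_def)
  then have "linear_ext R \<phi> (\<lambda>x. c \<otimes> f x) y = (\<Oplus>g\<in>?A. if \<phi> g = y then c \<otimes> f g else \<zero>)"
    using assms by (intro linear_ext_eq) auto
  also have "\<dots> = (\<Oplus>g\<in>?A. c \<otimes> (if \<phi> g = y then f g else \<zero>))"
    using assms by (intro finsum_cong') auto
  also have "\<dots> = c \<otimes> linear_ext R \<phi> f y"
    using assms by (subst finsum_rdistr[symmetric]) (auto simp: linear_ext_eq[of _ ?A])
  finally show "linear_ext R \<phi> (\<lambda>x. c \<otimes> f x) y = c \<otimes> linear_ext R \<phi> f y" .
qed

lemma supp_basis_elt [simp]: "supp R (basis_elt R g) = {g}"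
  unfolding supp_def basis_elt_def by auto

lemma linear_ext_basis: "linear_ext R \<phi> (basis_elt R g) = basis_elt R (\<phi> g)"
proof
  fix y
  show "linear_ext R \<phi> (basis_elt R g) y = basis_elt R (\<phi> g) y"
    by (subst linear_ext_eq[of _ "{g}"]) (simp_all, simp_all add: basis_elt_def)
qed

lemma supp_linear_ext:
  assumes "\<forall>x. f x \<in> carrier R" 
  shows "supp R (linear_ext R \<phi> f) \<subseteq> \<phi> ` supp R f"
proof
  fix y assume "y \<in> supp R (linear_ext R \<phi> f)"
  then have "{g \<in> supp R f. \<phi> g = y} \<noteq> {}"
    by (auto simp: supp_def linear_ext_def simp del: Collect_empty_eq)
  then show "y \<in> \<phi> ` supp R f"
    by auto
qed

end

text \<open>The convolution product is the linear extension of the group law evaluated on this tensor product,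
  so its bilinearity follows from the linearity of \<^const>\<open>linear_ext\<close>.\<close>

definition tensor :: "('k, 'u) ring_scheme \<Rightarrow> ('g \<Rightarrow> 'k) \<Rightarrow> ('h \<Rightarrow> 'k) \<Rightarrow> 'g \<times> 'h \<Rightarrow> 'k" where
  "tensor K f f' = (\<lambda>(g, h). f g \<otimes>\<^bsub>K\<^esub> f' h)"

lemma group_algebra_simps [simp]:
  "zero (group_algebra K G) = (\<lambda>x. \<zero>\<^bsub>K\<^esub>)"
  "f \<oplus>\<^bsub>group_algebra K G\<^esub> f' = (\<lambda>x. f x \<oplus>\<^bsub>K\<^esub> f' x)"
  "c \<odot>\<^bsub>group_algebra K G\<^esub> f = (\<lambda>x. c \<otimes>\<^bsub>K\<^esub> f x)"
  "one (group_algebra K G) = basis_elt K \<one>\<^bsub>G\<^esub>"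
  by (simp_all add: group_algebra_def)

lemma group_algebra_carrier_iff:
  "f \<in> carrier (group_algebra K G) \<longleftrightarrow>
    (\<forall>x. f x \<in> carrier K) \<and> finite (supp K f) \<and> supp K f \<subseteq> carrier G"
  by (auto simp: group_algebra_def)

lemma group_algebra_carrierD:
  assumes "f \<in> carrier (group_algebra K G)"
  shows "\<forall>x. f x \<in> carrier K" "finite (supp K f)" "supp K f \<subseteq> carrier G" "f x \<in> carrier K"
  using assms by (auto simp: group_algebra_carrier_iff)

context field
begin

text \<open>Equality, and not just an inclusion, since a field has no zero divisors.\<close>

lemma supp_tensor:
  assumes "\<forall>x. f x \<in> carrier R" "\<forall>x. f' x \<in> carrier R"
  shows "supp R (tensor R f f') = supp R f \<times> supp R f'"
proof -
  have "f a \<otimes> f' b \<noteq> \<zero> \<longleftrightarrow> f a \<noteq> \<zero> \<and> f' b \<noteq> \<zero>" for a b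
    using assms by (simp add: integral_iff)
  then show ?thesis
    by (auto simp: supp_def tensor_def)
qed

lemma tensor_range:
  assumes "\<forall>x. f x \<in> carrier R" "\<forall>x. f' x \<in> carrier R"
  shows "\<forall>p. tensor R f f' p \<in> carrier R"
  using assms by (simp add: tensor_def case_prod_unfold)

lemma group_algebra_mult:
  assumes "f \<in> carrier (group_algebra R G)" "f' \<in> carrier (group_algebra R G)"
  shows "f \<otimes>\<^bsub>group_algebra R G\<^esub> f' = linear_ext R (\<lambda>(g, h). g \<otimes>\<^bsub>G\<^esub> h) (tensor R f f')"
proof -
  have "{p \<in> supp R f \<times> supp R f'. (case p of (g, h) \<Rightarrow> g \<otimes>\<^bsub>G\<^esub> h) = x} =
      {(g, h) \<in> supp R f \<times> supp R f'. g \<otimes>\<^bsub>G\<^esub> h = x}" for x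
    by auto
  then show ?thesis
    using group_algebra_carrierD[OF assms(1)] group_algebra_carrierD[OF assms(2)]
    by (simp add: linear_ext_def supp_tensor) (simp add: group_algebra_def tensor_def case_prod_unfold)
qed

lemma basis_elt_closed [simp]:
  "g \<in> carrier G \<Longrightarrow> basis_elt R g \<in> carrier (group_algebra R G)"
  by (auto simp: group_algebra_carrier_iff) (auto simp: basis_elt_def)

lemma group_algebra_add_closed:
  assumes "f \<in> carrier (group_algebra R G)" "f' \<in> carrier (group_algebra R G)"
  shows "(\<lambda>x. f x \<oplus> f' x) \<in> carrier (group_algebra R G)"
proof -
  have "supp R (\<lambda>x. f x \<oplus> f' x) \<subseteq> supp R f \<union> supp R f'"
    by (auto simp: supp_def)
  then show ?thesis
    using assms unfolding group_algebra_carrier_iff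
    by (auto intro: finite_subset[of _ "supp R f \<union> supp R f'"])
qed

lemma group_algebra_smult_closed:
  assumes "c \<in> carrier R" "f \<in> carrier (group_algebra R G)"
  shows "(\<lambda>x. c \<otimes> f x) \<in> carrier (group_algebra R G)"
proof -
  have "supp R (\<lambda>x. c \<otimes> f x) \<subseteq> supp R f"
    using assms by (auto simp: supp_def)
  then show ?thesis
    using assms unfolding group_algebra_carrier_iff
    by (auto intro: finite_subset[of _ "supp R f"])
qed

lemma group_algebra_zero_closed: "(\<lambda>x. \<zero>) \<in> carrier (group_algebra R G)"
  by (auto simp: group_algebra_carrier_iff supp_def)

lemma linear_ext_in_group_algebra:
  assumes "f \<in> carrier (group_algebra R G)" "\<phi> \<in> carrier G \<rightarrow> carrier H"
  shows "linear_ext R \<phi> f \<in> carrier (group_algebra R H)"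
proof -
  note f = group_algebra_carrierD[OF assms(1)]
  have "supp R (linear_ext R \<phi> f) \<subseteq> \<phi> ` supp R f"
    using f(1) by (rule supp_linear_ext)
  moreover have "finite (\<phi> ` supp R f)" "\<phi> ` supp R f \<subseteq> carrier H"
    using f assms(2) by auto
  ultimately show ?thesis
    using linear_ext_closed[OF f(1), of \<phi>] finite_subset unfolding group_algebra_carrier_iff
    by (intro conjI allI) (assumption | fastforce)+
qed

lemma group_algebra_mult_closed:
  assumes "monoid G" "f \<in> carrier (group_algebra R G)" "f' \<in> carrier (group_algebra R G)"
  shows "f \<otimes>\<^bsub>group_algebra R G\<^esub> f' \<in> carrier (group_algebra R G)"
proof -
  have "tensor R f f' \<in> carrier (group_algebra R (G \<times>\<times> G))"
    using assms(2,3) unfolding group_algebra_carrier_iff by (auto simp: supp_tensor tensor_range)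
  then show ?thesis
    using assms by (auto simp: group_algebra_mult intro!: linear_ext_in_group_algebra monoid.m_closed)
qed

lemma group_algebra_mult_basis:
  assumes "g \<in> carrier G" "h \<in> carrier G"
  shows "basis_elt R g \<otimes>\<^bsub>group_algebra R G\<^esub> basis_elt R h = basis_elt R (g \<otimes>\<^bsub>G\<^esub> h)"
proof -
  have "tensor R (basis_elt R g) (basis_elt R h) = basis_elt R (g, h)"
    by (intro ext) (simp add: tensor_def basis_elt_def case_prod_unfold prod_eq_iff)
  then show ?thesis
    using assms by (simp add: group_algebra_mult linear_ext_basis)
qed

lemma group_algebra_l_distr:
  assumes "x \<in> carrier (group_algebra R G)" "y \<in> carrier (group_algebra R G)" "z \<in> carrier (group_algebra R G)"
  shows "(x \<oplus>\<^bsub>group_algebra R G\<^esub> y) \<otimes>\<^bsub>group_algebra R G\<^esub> z =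
    x \<otimes>\<^bsub>group_algebra R G\<^esub> z \<oplus>\<^bsub>group_algebra R G\<^esub> y \<otimes>\<^bsub>group_algebra R G\<^esub> z"
proof -
  note [simp] = group_algebra_carrierD[OF assms(1)] group_algebra_carrierD[OF assms(2)]
    group_algebra_carrierD[OF assms(3)]
  have "tensor R (\<lambda>g. x g \<oplus> y g) z = (\<lambda>p. tensor R x z p \<oplus> tensor R y z p)"
    using assms(1) by (intro ext) (simp add: tensor_def case_prod_unfold l_distr)
  then show ?thesis
    using assms by (simp add: group_algebra_mult group_algebra_add_closed
        linear_ext_add tensor_range supp_tensor)
qed

lemma group_algebra_r_distr:
  assumes "x \<in> carrier (group_algebra R G)" "y \<in> carrier (group_algebra R G)" "z \<in> carrier (group_algebra R G)"
  shows "z \<otimes>\<^bsub>group_algebra R G\<^esub> (x \<oplus>\<^bsub>group_algebra R G\<^esub> y) =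
    z \<otimes>\<^bsub>group_algebra R G\<^esub> x \<oplus>\<^bsub>group_algebra R G\<^esub> z \<otimes>\<^bsub>group_algebra R G\<^esub> y"
proof -
  note [simp] = group_algebra_carrierD[OF assms(1)] group_algebra_carrierD[OF assms(2)]
    group_algebra_carrierD[OF assms(3)]
  have "tensor R z (\<lambda>g. x g \<oplus> y g) = (\<lambda>p. tensor R z x p \<oplus> tensor R z y p)"
    using assms(1) by (intro ext) (simp add: tensor_def case_prod_unfold r_distr)
  then show ?thesis
    using assms by (simp add: group_algebra_mult group_algebra_add_closed
        linear_ext_add tensor_range supp_tensor)
qed

lemma group_algebra_smult_left:
  assumes "c \<in> carrier R" "x \<in> carrier (group_algebra R G)" "y \<in> carrier (group_algebra R G)"
  shows "(c \<odot>\<^bsub>group_algebra R G\<^esub> x) \<otimes>\<^bsub>group_algebra R G\<^esub> y =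
    c \<odot>\<^bsub>group_algebra R G\<^esub> (x \<otimes>\<^bsub>group_algebra R G\<^esub> y)"
proof -
  note [simp] = group_algebra_carrierD[OF assms(2)] group_algebra_carrierD[OF assms(3)]
  have "tensor R (\<lambda>g. c \<otimes> x g) y = (\<lambda>p. c \<otimes> tensor R x y p)"
    using assms(1) by (intro ext) (simp add: tensor_def case_prod_unfold m_assoc)
  then show ?thesis
    using assms by (simp add: group_algebra_mult group_algebra_smult_closed
        linear_ext_smult tensor_range supp_tensor)
qed

lemma group_algebra_smult_right:
  assumes "c \<in> carrier R" "x \<in> carrier (group_algebra R G)" "y \<in> carrier (group_algebra R G)"
  shows "x \<otimes>\<^bsub>group_algebra R G\<^esub> (c \<odot>\<^bsub>group_algebra R G\<^esub> y) =
    c \<odot>\<^bsub>group_algebra R G\<^esub> (x \<otimes>\<^bsub>group_algebra R G\<^esub> y)"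
proof -
  note [simp] = group_algebra_carrierD[OF assms(2)] group_algebra_carrierD[OF assms(3)]
  have "tensor R x (\<lambda>g. c \<otimes> y g) = (\<lambda>p. c \<otimes> tensor R x y p)"
    using assms(1) by (intro ext) (simp add: tensor_def case_prod_unfold m_lcomm)
  then show ?thesis
    using assms by (simp add: group_algebra_mult group_algebra_smult_closed
        linear_ext_smult tensor_range supp_tensor)
qed

text \<open>Linear identities in the group algebra reduce to group elements by this rule; multilinear ones
  follow by nesting it.\<close>

lemma group_algebra_induct [consumes 1, case_names zero basis add smult]:
  assumes f: "f \<in> carrier (group_algebra R G)"
    and zero: "P \<zero>\<^bsub>group_algebra R G\<^esub>"
    and basis: "\<And>g. g \<in> carrier G \<Longrightarrow> P (basis_elt R g)"
    and add: "\<And>f h. \<lbrakk>f \<in> carrier (group_algebra R G); h \<in> carrier (group_algebra R G); P f; P h\<rbrakk>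
      \<Longrightarrow> P (f \<oplus>\<^bsub>group_algebra R G\<^esub> h)"
    and smult: "\<And>c f. \<lbrakk>c \<in> carrier R; f \<in> carrier (group_algebra R G); P f\<rbrakk>
      \<Longrightarrow> P (c \<odot>\<^bsub>group_algebra R G\<^esub> f)"
  shows "P f"
proof -
  have "f \<in> carrier (group_algebra R G) \<Longrightarrow> supp R f \<subseteq> A \<Longrightarrow> P f" if "finite A" for A f
    using that
  proof (induction A arbitrary: f rule: finite_induct)
    case empty
    then have "f = \<zero>\<^bsub>group_algebra R G\<^esub>"
      by (auto simp: supp_def)
    then show ?case
      using zero by simp
  next
    case (insert a A)
    note carr = group_algebra_carrierD[OF insert.prems(1)]
    show ?case
    proof (cases "a \<in> supp R f")
      case True
      let ?h = "f(a := \<zero>)"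
      have "supp R ?h \<subseteq> supp R f \<inter> A"
        using insert.prems by (auto simp: supp_def)
      then have h: "?h \<in> carrier (group_algebra R G)" "P ?h"
      proof -
        assume supp: "supp R ?h \<subseteq> supp R f \<inter> A"
        then show "?h \<in> carrier (group_algebra R G)"
          unfolding group_algebra_carrier_iff using carr by (auto intro: finite_subset)
        then show "P ?h"
          using supp by (intro insert.IH) (simp_all del: fun_upd_apply)
      qed
      have a: "a \<in> carrier G"
        using True carr by auto
      have "f = ?h \<oplus>\<^bsub>group_algebra R G\<^esub> (f a \<odot>\<^bsub>group_algebra R G\<^esub> basis_elt R a)"
        using carr by (auto simp: basis_elt_def fun_eq_iff)
      moreover have "P (?h \<oplus>\<^bsub>group_algebra R G\<^esub> (f a \<odot>\<^bsub>group_algebra R G\<^esub> basis_elt R a))"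
        using a carr h by (intro add smult basis) (auto intro: group_algebra_smult_closed)
      ultimately show ?thesis
        by metis
    next
      case False
      then show ?thesis
        using insert by blast
    qed
  qed
  then show ?thesis
    using f group_algebra_carrierD(2)[OF f] by blast
qed

text \<open>From here on the ring and module laws apply to the operations as such, so they are no longer
  unfolded to pointwise formulas.\<close>

declare group_algebra_simps [simp del]

lemma group_algebra_abelian_group: "abelian_group (group_algebra R G)"
proof (rule abelian_groupI)
  let ?A = "group_algebra R G"
  fix x assume x: "x \<in> carrier ?A"
  have "\<ominus> \<one> \<in> carrier R"
    by simp
  then have "(\<lambda>g. \<ominus> \<one> \<otimes> x g) \<in> carrier ?A"
    using x by (rule group_algebra_smult_closed)
  moreover have "(\<lambda>g. \<ominus> \<one> \<otimes> x g) \<oplus>\<^bsub>?A\<^esub> x = \<zero>\<^bsub>?A\<^esub>"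
    using group_algebra_carrierD[OF x] by (simp add: group_algebra_simps l_minus l_neg)
  ultimately show "\<exists>y\<in>carrier ?A. y \<oplus>\<^bsub>?A\<^esub> x = \<zero>\<^bsub>?A\<^esub>"
    by (intro bexI[of _ "\<lambda>g. \<ominus> \<one> \<otimes> x g"])
qed (simp_all add: group_algebra_simps group_algebra_add_closed group_algebra_zero_closed
    group_algebra_carrierD(4)[where G = G] a_ac fun_eq_iff)

lemma group_algebra_module: "module R (group_algebra R G)"
  by (rule moduleI[OF is_cring group_algebra_abelian_group])
    (simp_all add: group_algebra_simps group_algebra_smult_closed group_algebra_carrierD(4)[where G = G]
      l_distr r_distr m_assoc)

lemma group_algebra_assoc_algebra:
  assumes "monoid G"
  shows "assoc_algebra R (group_algebra R G)"
proof -
  interpret G: monoid G by fact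
  let ?A = "group_algebra R G"
  interpret A: module R ?A by (rule group_algebra_module)
  note closed = group_algebra_mult_closed[OF assms]
  note bilin = group_algebra_l_distr group_algebra_r_distr group_algebra_smult_left group_algebra_smult_right
  have zero: "\<zero>\<^bsub>?A\<^esub> \<otimes>\<^bsub>?A\<^esub> x = \<zero>\<^bsub>?A\<^esub>" "x \<otimes>\<^bsub>?A\<^esub> \<zero>\<^bsub>?A\<^esub> = \<zero>\<^bsub>?A\<^esub>" if "x \<in> carrier ?A" for x
    using that group_algebra_smult_left[of \<zero> "\<zero>\<^bsub>?A\<^esub>" G x] group_algebra_smult_right[of \<zero> x G "\<zero>\<^bsub>?A\<^esub>"]
    by (simp_all add: closed)
  have assoc: "(x \<otimes>\<^bsub>?A\<^esub> y) \<otimes>\<^bsub>?A\<^esub> z = x \<otimes>\<^bsub>?A\<^esub> (y \<otimes>\<^bsub>?A\<^esub> z)"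
    if x: "x \<in> carrier ?A" and y: "y \<in> carrier ?A" and z: "z \<in> carrier ?A" for x y z
    using x
  proof (induction x rule: group_algebra_induct)
    case (basis g)
    show ?case
      using y
    proof (induction y rule: group_algebra_induct)
      case (basis h)
      show ?case
        using z by (induction z rule: group_algebra_induct)
          (use basis \<open>g \<in> carrier G\<close> in \<open>simp_all add: zero bilin closed group_algebra_mult_basis G.m_assoc\<close>)
    qed (use basis z in \<open>simp_all add: zero bilin closed\<close>)
  qed (use y z in \<open>simp_all add: zero bilin closed\<close>)
  have unit: "\<one>\<^bsub>?A\<^esub> \<otimes>\<^bsub>?A\<^esub> x = x \<and> x \<otimes>\<^bsub>?A\<^esub> \<one>\<^bsub>?A\<^esub> = x" if "x \<in> carrier ?A" for x
    using that by (induction x rule: group_algebra_induct)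
      (simp_all add: zero bilin closed group_algebra_mult_basis group_algebra_simps(4))
  moreover have "\<one>\<^bsub>?A\<^esub> \<in> carrier ?A"
    by (simp add: group_algebra_simps(4))
  ultimately have "monoid ?A"
    by (intro monoidI) (simp_all add: closed assoc)
  then have "ring ?A"
    by (intro ringI group_algebra_abelian_group bilin)
  then show ?thesis
    by (intro assoc_algebra.intro assoc_algebra_axioms.intro field_axioms group_algebra_module bilin)
qed

end

section \<open>Homomorphisms and quotients of algebras\<close>

lemma algebra_homI:
  assumes "\<And>x. x \<in> carrier A \<Longrightarrow> h x \<in> carrier B"
    and "\<And>x y. \<lbrakk>x \<in> carrier A; y \<in> carrier A\<rbrakk> \<Longrightarrow> h (x \<otimes>\<^bsub>A\<^esub> y) = h x \<otimes>\<^bsub>B\<^esub> h y"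
    and "\<And>x y. \<lbrakk>x \<in> carrier A; y \<in> carrier A\<rbrakk> \<Longrightarrow> h (x \<oplus>\<^bsub>A\<^esub> y) = h x \<oplus>\<^bsub>B\<^esub> h y"
    and "h \<one>\<^bsub>A\<^esub> = \<one>\<^bsub>B\<^esub>"
    and "\<And>c x. \<lbrakk>c \<in> carrier K; x \<in> carrier A\<rbrakk> \<Longrightarrow> h (c \<odot>\<^bsub>A\<^esub> x) = c \<odot>\<^bsub>B\<^esub> h x"
  shows "h \<in> algebra_hom K A B"
proof -
  have "h \<in> ring_hom A B"
    by (rule ring_hom_memI) (fact assms(1-4))+
  then show ?thesis
    using assms(5) by (simp add: algebra_hom_def)
qed

lemma algebra_homD:
  assumes "h \<in> algebra_hom K A B"
  shows "x \<in> carrier A \<Longrightarrow> h x \<in> carrier B"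
    and "\<lbrakk>x \<in> carrier A; y \<in> carrier A\<rbrakk> \<Longrightarrow> h (x \<otimes>\<^bsub>A\<^esub> y) = h x \<otimes>\<^bsub>B\<^esub> h y"
    and "\<lbrakk>x \<in> carrier A; y \<in> carrier A\<rbrakk> \<Longrightarrow> h (x \<oplus>\<^bsub>A\<^esub> y) = h x \<oplus>\<^bsub>B\<^esub> h y"
    and "h \<one>\<^bsub>A\<^esub> = \<one>\<^bsub>B\<^esub>"
    and "\<lbrakk>c \<in> carrier K; x \<in> carrier A\<rbrakk> \<Longrightarrow> h (c \<odot>\<^bsub>A\<^esub> x) = c \<odot>\<^bsub>B\<^esub> h x"
  using assms unfolding algebra_hom_def ring_hom_def by blast+

lemma algebra_hom_compose:
  assumes "h \<in> algebra_hom K A B" "h' \<in> algebra_hom K B C"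
  shows "(\<lambda>x. h' (h x)) \<in> algebra_hom K A C"
  by (rule algebra_homI) (simp_all add: algebra_homD[OF assms(1)] algebra_homD[OF assms(2)])

lemma assoc_algebra_ring: "assoc_algebra K A \<Longrightarrow> ring A"
  by (simp add: assoc_algebra_def)

lemma algebra_hom_ring:
  assumes "assoc_algebra K A" "assoc_algebra K B" "h \<in> algebra_hom K A B"
  shows "ring_hom_ring A B h"
  using assms by (auto intro!: ring_hom_ringI2 assoc_algebra_ring simp: algebra_hom_def)

text \<open>The axioms of an algebra are equations, so they pass from \<open>A\<close> to any structure that \<open>A\<close> maps onto.
  The zero is required separately because a ring homomorphism into a structure that is not yet known
  to be a ring need not preserve it.\<close>

lemma assoc_algebra_image:
  assumes A: "assoc_algebra K A" and h: "h \<in> algebra_hom K A B" "h \<zero>\<^bsub>A\<^esub> = \<zero>\<^bsub>B\<^esub>"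
    and surj: "h ` carrier A = carrier B"
  shows "assoc_algebra K B"
proof -
  interpret K: field K using A by (simp add: assoc_algebra_def)
  interpret ring A using A by (simp add: assoc_algebra_def)
  interpret M: module K A using A by (simp add: assoc_algebra_def)
  note hom = algebra_homD[OF h(1)]
  note [simp] = hom(2-)[symmetric] h(2)[symmetric]
  have "abelian_group B"
  proof (rule abelian_groupI)
    fix x assume "x \<in> carrier B"
    then obtain a where a: "x = h a" "a \<in> carrier A"
      using surj by auto
    then have "h (\<ominus>\<^bsub>A\<^esub> a) \<oplus>\<^bsub>B\<^esub> x = \<zero>\<^bsub>B\<^esub>"
      by (simp add: l_neg)
    then show "\<exists>y\<in>carrier B. y \<oplus>\<^bsub>B\<^esub> x = \<zero>\<^bsub>B\<^esub>"
      using a hom(1) by blast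
  qed (auto simp flip: surj simp: a_ac)
  moreover have "monoid B"
    by (rule monoidI) (auto simp flip: surj simp: m_assoc)
  ultimately have "ring B"
    by (rule ringI) (auto simp flip: surj simp: l_distr r_distr)
  moreover have "module K B"
    by (rule moduleI[OF K.is_cring \<open>abelian_group B\<close>])
      (auto simp flip: surj simp: M.smult_l_distr M.smult_r_distr M.smult_assoc1)
  moreover have "assoc_algebra_axioms K B"
    by (rule assoc_algebra_axioms.intro)
      (auto simp flip: surj simp: assoc_algebra.smult_mult_left[OF A] assoc_algebra.smult_mult_right[OF A])
  ultimately show ?thesis
    by (intro assoc_algebra.intro K.field_axioms)
qed

lemma quotient_algebra_carrier:
  "carrier (quotient_algebra A J) = (\<lambda>x. J +>\<^bsub>A\<^esub> x) ` carrier A"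
  by (auto simp: quotient_algebra_def FactRing_def A_RCOSETS_def' a_r_coset_def)

locale algebra_ideal =
  fixes K :: "('k, 'u) ring_scheme" and A :: "('k, 'a, 'v) module_scheme" and J
  assumes assoc_algebra: "assoc_algebra K A" and ideal: "ideal J A"
begin

sublocale ring A using assoc_algebra by (rule assoc_algebra_ring)
sublocale J: ideal J A by (rule ideal)

lemma smult_closed: "\<lbrakk>c \<in> carrier K; x \<in> carrier A\<rbrakk> \<Longrightarrow> c \<odot>\<^bsub>A\<^esub> x \<in> carrier A"
  using assoc_algebra by (auto simp: assoc_algebra_def intro: module.smult_closed)

text \<open>A ring ideal of a unital algebra is a subspace, because \<open>c j = (c 1) j\<close>.\<close>

lemma smult_in_ideal:
  assumes "c \<in> carrier K" "j \<in> J"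
  shows "c \<odot>\<^bsub>A\<^esub> j \<in> J"
proof -
  have "c \<odot>\<^bsub>A\<^esub> j = (c \<odot>\<^bsub>A\<^esub> \<one>\<^bsub>A\<^esub>) \<otimes>\<^bsub>A\<^esub> j"
    using assms assoc_algebra.smult_mult_left[OF assoc_algebra, of c "\<one>\<^bsub>A\<^esub>" j] by (simp add: J.Icarr)
  then show ?thesis
    using assms by (simp add: J.I_l_closed smult_closed)
qed

lemma quotient_smult:
  assumes "c \<in> carrier K" "a \<in> carrier A"
  shows "c \<odot>\<^bsub>quotient_algebra A J\<^esub> (J +>\<^bsub>A\<^esub> a) = J +>\<^bsub>A\<^esub> (c \<odot>\<^bsub>A\<^esub> a)"
proof -
  have "J +>\<^bsub>A\<^esub> (c \<odot>\<^bsub>A\<^esub> x) = J +>\<^bsub>A\<^esub> (c \<odot>\<^bsub>A\<^esub> a)" if "x \<in> J +>\<^bsub>A\<^esub> a" for x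
  proof -
    from that obtain j where j: "j \<in> J" "x = j \<oplus>\<^bsub>A\<^esub> a"
      by (auto simp: a_r_coset_def')
    then have "c \<odot>\<^bsub>A\<^esub> x = c \<odot>\<^bsub>A\<^esub> j \<oplus>\<^bsub>A\<^esub> c \<odot>\<^bsub>A\<^esub> a"
      using assms assoc_algebra by (auto simp: assoc_algebra_def J.Icarr intro: module.smult_r_distr)
    then have "c \<odot>\<^bsub>A\<^esub> x \<in> J +>\<^bsub>A\<^esub> (c \<odot>\<^bsub>A\<^esub> a)"
      using assms j by (auto simp: a_r_coset_def' smult_in_ideal)
    then show ?thesis
      using assms by (intro J.a_repr_independence'[symmetric] smult_closed)
  qed
  moreover have "a \<in> J +>\<^bsub>A\<^esub> a"
    using assms by (intro J.a_rcos_self)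
  ultimately have "(\<Union>x\<in>J +>\<^bsub>A\<^esub> a. J +>\<^bsub>A\<^esub> (c \<odot>\<^bsub>A\<^esub> x)) = J +>\<^bsub>A\<^esub> (c \<odot>\<^bsub>A\<^esub> a)"
    by blast
  then show ?thesis
    by (simp add: quotient_algebra_def)
qed

lemma coset_hom: "(\<lambda>x. J +>\<^bsub>A\<^esub> x) \<in> algebra_hom K A (quotient_algebra A J)"
  using J.rcos_ring_hom
  by (auto simp: algebra_hom_def quotient_smult) (simp add: ring_hom_def quotient_algebra_def)

lemma zero_quotient: "\<zero>\<^bsub>quotient_algebra A J\<^esub> = J"
  by (simp add: quotient_algebra_def FactRing_def)

lemma coset_eq_zero_iff:
  assumes "x \<in> carrier A"
  shows "J +>\<^bsub>A\<^esub> x = \<zero>\<^bsub>quotient_algebra A J\<^esub> \<longleftrightarrow> x \<in> J"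
  using assms J.a_rcos_const J.rcos_const_imp_mem by (auto simp: zero_quotient)

lemma assoc_algebra_quotient: "assoc_algebra K (quotient_algebra A J)"
  by (rule assoc_algebra_image[OF assoc_algebra coset_hom])
    (simp_all add: coset_eq_zero_iff quotient_algebra_carrier)

lemma coset_map_eq:
  assumes B: "assoc_algebra K B" and h: "h \<in> algebra_hom K A B" "\<And>j. j \<in> J \<Longrightarrow> h j = \<zero>\<^bsub>B\<^esub>"
    and x: "x \<in> carrier A"
  shows "coset_map h (J +>\<^bsub>A\<^esub> x) = h x"
proof -
  interpret B: ring B using B by (rule assoc_algebra_ring)
  have "h (j \<oplus>\<^bsub>A\<^esub> x) = h x" if "j \<in> J" for j
    using that x h by (simp add: algebra_homD[OF h(1)] J.Icarr)
  moreover have "J \<noteq> {}"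
    using additive_subgroup.zero_closed[OF J.is_additive_subgroup] by blast
  ultimately have "(\<lambda>j. h (j \<oplus>\<^bsub>A\<^esub> x)) ` J = {h x}"
    by (simp add: image_constant_conv cong: image_cong_simp)
  moreover have "J +>\<^bsub>A\<^esub> x = (\<lambda>j. j \<oplus>\<^bsub>A\<^esub> x) ` J"
    by (auto simp: a_r_coset_def')
  ultimately have "h ` (J +>\<^bsub>A\<^esub> x) = {h x}"
    by (simp add: image_image)
  then show ?thesis
    by (simp add: coset_map_def)
qed

lemma coset_map_hom:
  assumes B: "assoc_algebra K B" and h: "h \<in> algebra_hom K A B" "\<And>j. j \<in> J \<Longrightarrow> h j = \<zero>\<^bsub>B\<^esub>"
  shows "coset_map h \<in> algebra_hom K (quotient_algebra A J) B"
proof -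
  note [simp] = coset_map_eq[OF assms] algebra_homD[OF h(1)]
  note coset = algebra_homD(2-)[OF coset_hom, symmetric]
  show ?thesis
    by (rule algebra_homI) (auto simp: quotient_algebra_carrier coset smult_closed)
qed

end

text \<open>The kernel is an ideal, so it contains the ideal generated by any of its subsets.\<close>

lemma algebra_hom_genideal_zero:
  assumes A: "assoc_algebra K A" and B: "assoc_algebra K B" and h: "h \<in> algebra_hom K A B"
    and S: "S \<subseteq> carrier A" "\<And>s. s \<in> S \<Longrightarrow> h s = \<zero>\<^bsub>B\<^esub>" and x: "x \<in> Idl\<^bsub>A\<^esub> S"
  shows "h x = \<zero>\<^bsub>B\<^esub>"
proof -
  interpret ring_hom_ring A B h using A B h by (rule algebra_hom_ring)
  have "S \<subseteq> a_kernel A B h"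
    unfolding a_kernel_def' using S by blast
  then have "Idl\<^bsub>A\<^esub> S \<subseteq> a_kernel A B h"
    by (intro R.genideal_minimal kernel_is_ideal)
  then show ?thesis
    using x unfolding a_kernel_def' by blast
qed

lemma (in ring) minus_mult_minus:
  assumes "a \<in> carrier R" "b \<in> carrier R" "c \<in> carrier R" "d \<in> carrier R"
  shows "(a \<ominus> b) \<otimes> (c \<ominus> d) = a \<otimes> c \<ominus> a \<otimes> d \<ominus> b \<otimes> c \<oplus> b \<otimes> d"
  using assms by (simp add: minus_eq l_distr r_distr l_minus r_minus minus_add minus_minus a_ac)

text \<open>The hypotheses \<open>0 \<in> I\<close>, \<open>0 \<in> J\<close> guard against the empty product set.\<close>

lemma (in ring) ideal_prod_eq_zero:
  assumes "\<zero> \<in> I" "\<zero> \<in> J" "\<And>i j. \<lbrakk>i \<in> I; j \<in> J\<rbrakk> \<Longrightarrow> i \<otimes> j = \<zero>"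
  shows "I \<cdot> J = {\<zero>}"
proof
  show "I \<cdot> J \<subseteq> {\<zero>}"
  proof
    fix x assume "x \<in> I \<cdot> J"
    then show "x \<in> {\<zero>}"
      by (induction rule: ideal_prod.induct) (simp_all add: assms(3))
  qed
  show "{\<zero>} \<subseteq> I \<cdot> J"
    using ideal_prod.prod[OF assms(1,2), of R] by simp
qed

section \<open>Functoriality of the group algebra and four-term sums\<close>

lemma (in field) linear_ext_algebra_hom:
  assumes G: "monoid G" and H: "monoid H" and \<phi>: "\<phi> \<in> hom G H" "\<phi> \<one>\<^bsub>G\<^esub> = \<one>\<^bsub>H\<^esub>"
  shows "linear_ext R \<phi> \<in> algebra_hom R (group_algebra R G) (group_algebra R H)"
proof -
  let ?A = "group_algebra R G" and ?B = "group_algebra R H"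
  interpret A: assoc_algebra R ?A using G by (rule group_algebra_assoc_algebra)
  interpret B: assoc_algebra R ?B using H by (rule group_algebra_assoc_algebra)
  interpret A': ring ?A using A.assoc_algebra_axioms by (rule assoc_algebra_ring)
  interpret B': ring ?B using B.assoc_algebra_axioms by (rule assoc_algebra_ring)
  have closed: "linear_ext R \<phi> x \<in> carrier ?B" if "x \<in> carrier ?A" for x
    using that \<phi> by (intro linear_ext_in_group_algebra) (auto simp: hom_def)
  have add: "linear_ext R \<phi> (x \<oplus>\<^bsub>?A\<^esub> y) = linear_ext R \<phi> x \<oplus>\<^bsub>?B\<^esub> linear_ext R \<phi> y"
    if "x \<in> carrier ?A" "y \<in> carrier ?A" for x y
    using group_algebra_carrierD[OF that(1)] group_algebra_carrierD[OF that(2)]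
    by (simp add: group_algebra_simps linear_ext_add)
  have smult: "linear_ext R \<phi> (c \<odot>\<^bsub>?A\<^esub> x) = c \<odot>\<^bsub>?B\<^esub> linear_ext R \<phi> x"
    if "c \<in> carrier R" "x \<in> carrier ?A" for c x
    using that(1) group_algebra_carrierD[OF that(2)]
    by (simp add: group_algebra_simps linear_ext_smult)
  have zero: "linear_ext R \<phi> \<zero>\<^bsub>?A\<^esub> = \<zero>\<^bsub>?B\<^esub>"
    by (simp add: linear_ext_def group_algebra_simps(1) supp_def)
  note linear = closed add smult zero
  note bilin = group_algebra_l_distr group_algebra_r_distr group_algebra_smult_left group_algebra_smult_right
  have mult: "linear_ext R \<phi> (x \<otimes>\<^bsub>?A\<^esub> y) = linear_ext R \<phi> x \<otimes>\<^bsub>?B\<^esub> linear_ext R \<phi> y"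
    if x: "x \<in> carrier ?A" and y: "y \<in> carrier ?A" for x y
    using x
  proof (induction x rule: group_algebra_induct)
    case (basis g)
    show ?case
      using y by (induction y rule: group_algebra_induct)
        (use basis \<phi> in \<open>simp_all add: linear bilin linear_ext_basis group_algebra_mult_basis hom_def Pi_iff\<close>)
  qed (use y in \<open>simp_all add: linear bilin\<close>)
  have one: "linear_ext R \<phi> \<one>\<^bsub>?A\<^esub> = \<one>\<^bsub>?B\<^esub>"
    by (simp only: group_algebra_simps(4) linear_ext_basis \<phi>(2))
  show ?thesis
    by (intro algebra_homI closed add smult mult one)
qed

lemma (in field) linear_ext_fixed:
  assumes f: "f \<in> carrier (group_algebra R H)" and \<phi>: "\<And>g. g \<in> carrier H \<Longrightarrow> \<phi> g = g"
  shows "linear_ext R \<phi> f = f"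
  using f
proof (induction f rule: group_algebra_induct)
  case zero
  show ?case
    by (simp add: linear_ext_def supp_def group_algebra_simps)
next
  case (basis g)
  then show ?case
    by (simp add: linear_ext_basis \<phi>)
next
  case (add f h)
  then show ?case
    using group_algebra_carrierD[OF add(1)] group_algebra_carrierD[OF add(2)]
    by (simp add: group_algebra_simps linear_ext_add)
next
  case (smult c f)
  then show ?case
    using group_algebra_carrierD[OF smult(2)]
    by (simp add: group_algebra_simps linear_ext_smult)
qed

lemma subgroup_algebra_inclusion:
  assumes "H \<subseteq> carrier G"
  shows "(\<lambda>x. x) \<in> algebra_hom K (group_algebra K (G\<lparr>carrier := H\<rparr>)) (group_algebra K G)"
  using assms by (intro algebra_homI) (auto simp: group_algebra_def)

lemma four_term_hom:
  assumes A: "assoc_algebra K A" and B: "assoc_algebra K B" and h: "h \<in> algebra_hom K A B"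
    and basis: "\<And>g. g \<in> G \<Longrightarrow> basis_elt K g \<in> carrier A" "\<And>g. g \<in> G \<Longrightarrow> h (basis_elt K g) = basis_elt K (\<phi> g)"
    and G: "a \<in> G" "b \<in> G" "c \<in> G" "d \<in> G"
  shows "h (four_term K A a b c d) = four_term K B (\<phi> a) (\<phi> b) (\<phi> c) (\<phi> d)"
proof -
  interpret ring_hom_ring A B h using A B h by (rule algebra_hom_ring)
  show "h (four_term K A a b c d) = four_term K B (\<phi> a) (\<phi> b) (\<phi> c) (\<phi> d)"
    using G by (simp add: four_term_def R.minus_eq S.minus_eq basis flip: basis(2))
qed

context field
begin

lemma four_term_closed:
  assumes "monoid G" "a \<in> carrier G" "b \<in> carrier G" "c \<in> carrier G" "d \<in> carrier G"
  shows "four_term R (group_algebra R G) a b c d \<in> carrier (group_algebra R G)"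
proof -
  interpret ring "group_algebra R G"
    using group_algebra_assoc_algebra[OF assms(1)] by (rule assoc_algebra_ring)
  show ?thesis
    using assms(2-) by (simp add: four_term_def)
qed

lemma four_term_swap:
  assumes "monoid G" "a \<in> carrier G" "b \<in> carrier G" "c \<in> carrier G" "d \<in> carrier G"
  shows "four_term R (group_algebra R G) a b c d = four_term R (group_algebra R G) a c b d"
proof -
  interpret ring "group_algebra R G"
    using group_algebra_assoc_algebra[OF assms(1)] by (rule assoc_algebra_ring)
  show ?thesis
    using assms(2-) by (simp add: four_term_def minus_eq a_ac)
qed

text \<open>Together with a swap of the middle terms these are all the cancellations that occur when the
  structural maps are applied to generators.\<close>

lemma four_term_degenerate:
  assumes "monoid G" "a \<in> carrier G" "b \<in> carrier G"
  shows "four_term R (group_algebra R G) a a b b = \<zero>\<^bsub>group_algebra R G\<^esub>"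
    and "four_term R (group_algebra R G) a b a b = \<zero>\<^bsub>group_algebra R G\<^esub>"
proof -
  interpret ring "group_algebra R G"
    using group_algebra_assoc_algebra[OF assms(1)] by (rule assoc_algebra_ring)
  show aabb: "four_term R (group_algebra R G) a a b b = \<zero>\<^bsub>group_algebra R G\<^esub>"
    using assms(2-) by (simp add: four_term_def minus_eq r_neg l_neg a_assoc)
  then show "four_term R (group_algebra R G) a b a b = \<zero>\<^bsub>group_algebra R G\<^esub>"
    using assms four_term_swap[of G a a b b] by simp
qed

text \<open>This identifies a product of defects of group elements with the shape of the generators of the
  ideals.\<close>

lemma basis_defect_product:
  assumes "monoid G" "g \<in> carrier G" "g' \<in> carrier G" "h \<in> carrier G" "h' \<in> carrier G"
  shows "(basis_elt R g \<ominus>\<^bsub>group_algebra R G\<^esub> basis_elt R g') \<otimes>\<^bsub>group_algebra R G\<^esub>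
      (basis_elt R h \<ominus>\<^bsub>group_algebra R G\<^esub> basis_elt R h') =
    four_term R (group_algebra R G) (g \<otimes>\<^bsub>G\<^esub> h) (g \<otimes>\<^bsub>G\<^esub> h') (g' \<otimes>\<^bsub>G\<^esub> h) (g' \<otimes>\<^bsub>G\<^esub> h')"
proof -
  interpret A: ring "group_algebra R G"
    using group_algebra_assoc_algebra[OF assms(1)] by (rule assoc_algebra_ring)
  show ?thesis
    using assms(2-) by (simp add: A.minus_mult_minus group_algebra_mult_basis four_term_def)
qed

text \<open>The defect \<open>x - s x\<close> is linear in \<open>x\<close>, and an ideal is a subspace, so membership of the products
  of defects can be tested on group elements.\<close>

lemma defect_product_in_ideal:
  assumes G: "monoid G" and J: "ideal J (group_algebra R G)"
    and s: "s \<in> algebra_hom R (group_algebra R G) (group_algebra R G)"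
    and t: "t \<in> algebra_hom R (group_algebra R G) (group_algebra R G)"
    and basis: "\<And>g h. \<lbrakk>g \<in> carrier G; h \<in> carrier G\<rbrakk> \<Longrightarrow>
      (basis_elt R g \<ominus>\<^bsub>group_algebra R G\<^esub> s (basis_elt R g)) \<otimes>\<^bsub>group_algebra R G\<^esub>
      (basis_elt R h \<ominus>\<^bsub>group_algebra R G\<^esub> t (basis_elt R h)) \<in> J"
    and x: "x \<in> carrier (group_algebra R G)" and y: "y \<in> carrier (group_algebra R G)"
  shows "(x \<ominus>\<^bsub>group_algebra R G\<^esub> s x) \<otimes>\<^bsub>group_algebra R G\<^esub> (y \<ominus>\<^bsub>group_algebra R G\<^esub> t y) \<in> J"
proof -
  let ?A = "group_algebra R G"
  have A: "assoc_algebra R ?A"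
    using G by (rule group_algebra_assoc_algebra)
  interpret J: algebra_ideal R ?A J
    by (rule algebra_ideal.intro[OF A J])
  interpret M: module R ?A
    by (rule group_algebra_module)
  define D where "D h x = x \<ominus>\<^bsub>?A\<^esub> h x" for h x
  have D_zero: "D h \<zero>\<^bsub>?A\<^esub> = \<zero>\<^bsub>?A\<^esub>" and D_closed: "x \<in> carrier ?A \<Longrightarrow> D h x \<in> carrier ?A"
    if h: "h \<in> algebra_hom R ?A ?A" for h x
  proof -
    interpret ring_hom_ring ?A ?A h
      using A A h by (rule algebra_hom_ring)
    show "D h \<zero>\<^bsub>?A\<^esub> = \<zero>\<^bsub>?A\<^esub>"
      by (simp add: D_def J.minus_eq)
    show "D h x \<in> carrier ?A" if "x \<in> carrier ?A"
      using that by (simp add: D_def)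
  qed
  have D_add: "D h (x \<oplus>\<^bsub>?A\<^esub> y) = D h x \<oplus>\<^bsub>?A\<^esub> D h y"
    if h: "h \<in> algebra_hom R ?A ?A" and xy: "x \<in> carrier ?A" "y \<in> carrier ?A" for h x y
  proof -
    interpret ring_hom_ring ?A ?A h
      using A A h by (rule algebra_hom_ring)
    show ?thesis
      using xy by (simp add: D_def J.minus_eq J.minus_add J.a_ac)
  qed
  have D_smult: "D h (c \<odot>\<^bsub>?A\<^esub> x) = c \<odot>\<^bsub>?A\<^esub> D h x"
    if h: "h \<in> algebra_hom R ?A ?A" and "x \<in> carrier ?A" "c \<in> carrier R" for h x c
    using that
    by (simp add: D_def J.minus_eq algebra_homD[OF h] M.smult_r_distr M.smult_r_minus)
  note D = D_zero D_closed D_add D_smult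
  note Ds = D[OF s] and Dt = D[OF t]
  note J_closed = additive_subgroup.zero_closed[OF J.J.is_additive_subgroup]
    additive_subgroup.a_closed[OF J.J.is_additive_subgroup] J.smult_in_ideal
  note bilin = J.l_distr J.r_distr group_algebra_smult_left group_algebra_smult_right
  have "D s x \<otimes>\<^bsub>?A\<^esub> D t y \<in> J"
    using x
  proof (induction x rule: group_algebra_induct)
    case (basis g)
    show ?case
      using y
    proof (induction y rule: group_algebra_induct)
      case (basis h)
      then show ?case
        using assms(5) \<open>g \<in> carrier G\<close> by (simp add: D_def)
    qed (use basis in \<open>simp_all add: Ds Dt J_closed bilin\<close>)
  qed (use y in \<open>simp_all add: Ds Dt J_closed bilin\<close>)
  then show ?thesis
    by (simp add: D_def)
qed

end

section \<open>The induced maps between the quotients\<close>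

locale crossed_group_algebra = K: field K + two_crossed_module X
  for K :: "('k, 'u) ring_scheme" and X :: "('l, 'm, 'n) two_crossed_data"
begin

abbreviation "G3 \<equiv> semidirect_LMN X"
abbreviation "G2 \<equiv> semidirect_MN X"
abbreviation "G1 \<equiv> semidirect_N X"
abbreviation "A3 \<equiv> alg_LMN K X"
abbreviation "A2 \<equiv> alg_MN K X"
abbreviation "A1 \<equiv> alg_N K X"
abbreviation "s3 \<equiv> linear_ext K (\<lambda>(l, m, n). (\<one>\<^bsub>L\<^esub>, m, n))"
abbreviation "t3 \<equiv> linear_ext K (\<lambda>(l, m, n). (\<one>\<^bsub>L\<^esub>, d2 l \<otimes>\<^bsub>M\<^esub> m, n))"
abbreviation "s2 \<equiv> linear_ext K (\<lambda>(l, m, n). (\<one>\<^bsub>L\<^esub>, \<one>\<^bsub>M\<^esub>, n))"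
abbreviation "t2 \<equiv> linear_ext K (\<lambda>(l, m, n). (\<one>\<^bsub>L\<^esub>, \<one>\<^bsub>M\<^esub>, d1 m \<otimes>\<^bsub>N\<^esub> n))"

lemmas monoids = group.is_monoid[OF group_semidirect_LMN] group.is_monoid[OF group_semidirect_MN]
  group.is_monoid[OF group_semidirect_N]

lemma algebras: "assoc_algebra K A3" "assoc_algebra K A2" "assoc_algebra K A1"
  unfolding alg_LMN_def alg_MN_def alg_N_def
  by (rule K.group_algebra_assoc_algebra, rule monoids)+

lemma carriers:
  "carrier G2 = {\<one>\<^bsub>L\<^esub>} \<times> carrier M \<times> carrier N"
  "carrier G1 = {\<one>\<^bsub>L\<^esub>} \<times> {\<one>\<^bsub>M\<^esub>} \<times> carrier N"
  by (simp_all add: semidirect_MN_def semidirect_N_def)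

lemma mult_MN [simp]: "x \<otimes>\<^bsub>G2\<^esub> y = x \<otimes>\<^bsub>G3\<^esub> y" "x \<otimes>\<^bsub>G1\<^esub> y = x \<otimes>\<^bsub>G3\<^esub> y"
  by (simp_all add: semidirect_MN_def semidirect_N_def)

lemma one_MN [simp]: "\<one>\<^bsub>G2\<^esub> = \<one>\<^bsub>G3\<^esub>" "\<one>\<^bsub>G1\<^esub> = \<one>\<^bsub>G3\<^esub>"
  by (simp_all add: semidirect_MN_def semidirect_N_def)

lemma basis_closed:
  "\<lbrakk>l \<in> carrier L; m \<in> carrier M; n \<in> carrier N\<rbrakk> \<Longrightarrow> basis_elt K (l, m, n) \<in> carrier A3"
  "\<lbrakk>m \<in> carrier M; n \<in> carrier N\<rbrakk> \<Longrightarrow> basis_elt K (\<one>\<^bsub>L\<^esub>, m, n) \<in> carrier A2"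
  "n \<in> carrier N \<Longrightarrow> basis_elt K (\<one>\<^bsub>L\<^esub>, \<one>\<^bsub>M\<^esub>, n) \<in> carrier A1"
  by (simp_all add: alg_LMN_def alg_MN_def alg_N_def K.basis_elt_closed carriers)

text \<open>Every structural map comes from an endomorphism of the full semidirect product by restricting
  source and target to subgroups.\<close>

lemma linear_ext_hom_between_subgroups:
  assumes "\<phi> \<in> hom G3 G3" "\<phi> \<one>\<^bsub>G3\<^esub> = \<one>\<^bsub>G3\<^esub>" "monoid G" "monoid H"
    and "carrier G \<subseteq> carrier G3" "\<phi> ` carrier G \<subseteq> carrier H"
    and "\<And>x y. x \<otimes>\<^bsub>G\<^esub> y = x \<otimes>\<^bsub>G3\<^esub> y" "\<And>x y. x \<otimes>\<^bsub>H\<^esub> y = x \<otimes>\<^bsub>G3\<^esub> y" "\<one>\<^bsub>G\<^esub> = \<one>\<^bsub>G3\<^esub>" "\<one>\<^bsub>H\<^esub> = \<one>\<^bsub>G3\<^esub>"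
  shows "linear_ext K \<phi> \<in> algebra_hom K (group_algebra K G) (group_algebra K H)"
proof (rule K.linear_ext_algebra_hom[OF assms(3,4)])
  show "\<phi> \<in> hom G H"
  proof (rule homI)
    fix x y assume "x \<in> carrier G" "y \<in> carrier G"
    then show "\<phi> (x \<otimes>\<^bsub>G\<^esub> y) = \<phi> x \<otimes>\<^bsub>H\<^esub> \<phi> y"
      using assms(5) by (simp only: assms(7,8)) (rule hom_mult[OF assms(1)], auto)
  qed (use assms(6) in auto)
qed (simp only: assms)

lemma s3_hom: "s3 \<in> algebra_hom K A3 A2" and s3_endo: "s3 \<in> algebra_hom K A3 A3"
  unfolding alg_LMN_def alg_MN_def
  by (rule linear_ext_hom_between_subgroups[OF LMN_s3_hom]; auto simp: carriers monoids)+

lemma t3_hom: "t3 \<in> algebra_hom K A3 A2" and t3_endo: "t3 \<in> algebra_hom K A3 A3"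
  unfolding alg_LMN_def alg_MN_def
  by (rule linear_ext_hom_between_subgroups[OF LMN_t3_hom]; auto simp: carriers monoids)+

lemma s2_hom: "s2 \<in> algebra_hom K A2 A1"
  unfolding alg_MN_def alg_N_def
  by (rule linear_ext_hom_between_subgroups[OF LMN_s2_hom]; auto simp: carriers monoids)

lemma t2_hom: "t2 \<in> algebra_hom K A2 A1"
  unfolding alg_MN_def alg_N_def
  by (rule linear_ext_hom_between_subgroups[OF LMN_t2_hom]; auto simp: carriers monoids)

lemma incl3: "(\<lambda>x. x) \<in> algebra_hom K A2 A3"
  unfolding alg_LMN_def alg_MN_def semidirect_MN_def
  by (rule subgroup_algebra_inclusion) auto

lemma incl2: "(\<lambda>x. x) \<in> algebra_hom K A1 A2"
proof -
  have "G1 = G2\<lparr>carrier := {\<one>\<^bsub>L\<^esub>} \<times> {\<one>\<^bsub>M\<^esub>} \<times> carrier N\<rparr>"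
    by (simp add: semidirect_MN_def semidirect_N_def)
  then show ?thesis
    unfolding alg_N_def alg_MN_def
    by (simp only:) (rule subgroup_algebra_inclusion, auto simp: carriers)
qed

lemma sections:
  "x \<in> carrier A2 \<Longrightarrow> s3 x = x" "x \<in> carrier A2 \<Longrightarrow> t3 x = x"
  "x \<in> carrier A1 \<Longrightarrow> s2 x = x" "x \<in> carrier A1 \<Longrightarrow> t2 x = x"
  unfolding alg_MN_def alg_N_def
  by (erule K.linear_ext_fixed, auto simp: carriers)+

lemma four_term_closed3:
  "\<lbrakk>a \<in> carrier G3; b \<in> carrier G3; c \<in> carrier G3; d \<in> carrier G3\<rbrakk>
    \<Longrightarrow> four_term K A3 a b c d \<in> carrier A3"
  unfolding alg_LMN_def by (rule K.four_term_closed[OF monoids(1)])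

lemma four_term_closed2:
  "\<lbrakk>a \<in> carrier G2; b \<in> carrier G2; c \<in> carrier G2; d \<in> carrier G2\<rbrakk>
    \<Longrightarrow> four_term K A2 a b c d \<in> carrier A2"
  unfolding alg_MN_def by (rule K.four_term_closed[OF monoids(2)])

lemma four_term_linear_ext3:
  assumes "assoc_algebra K B" "linear_ext K \<phi> \<in> algebra_hom K A3 B"
    and "a \<in> carrier G3" "b \<in> carrier G3" "c \<in> carrier G3" "d \<in> carrier G3"
  shows "linear_ext K \<phi> (four_term K A3 a b c d) = four_term K B (\<phi> a) (\<phi> b) (\<phi> c) (\<phi> d)"
  using algebras(1) assms(1,2) _ K.linear_ext_basis assms(3-)
  by (rule four_term_hom) (simp add: alg_LMN_def K.basis_elt_closed del: carrier_LMN)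

lemma four_term_linear_ext2:
  assumes "assoc_algebra K B" "linear_ext K \<phi> \<in> algebra_hom K A2 B"
    and "a \<in> carrier G2" "b \<in> carrier G2" "c \<in> carrier G2" "d \<in> carrier G2"
  shows "linear_ext K \<phi> (four_term K A2 a b c d) = four_term K B (\<phi> a) (\<phi> b) (\<phi> c) (\<phi> d)"
  using algebras(2) assms(1,2) _ K.linear_ext_basis assms(3-)
  by (rule four_term_hom) (simp add: alg_MN_def K.basis_elt_closed)

text \<open>The four-term sum uses the subtraction of the algebra, which a priori refers to its carrier; a
  homomorphism preserves it.\<close>

lemma four_term_incl:
  assumes "a \<in> carrier G2" "b \<in> carrier G2" "c \<in> carrier G2" "d \<in> carrier G2"
  shows "four_term K A2 a b c d = four_term K A3 a b c d"
  using algebras(2,1) incl3 _ refl assms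
  by (rule four_term_hom) (simp add: alg_MN_def K.basis_elt_closed)

definition gens1 where
  "gens1 = {four_term K A2 (\<one>\<^bsub>L\<^esub>, m' \<otimes>\<^bsub>M\<^esub> m, n) (\<one>\<^bsub>L\<^esub>, m, n) (\<one>\<^bsub>L\<^esub>, m', d1 m \<otimes>\<^bsub>N\<^esub> n)
      (\<one>\<^bsub>L\<^esub>, \<one>\<^bsub>M\<^esub>, d1 m \<otimes>\<^bsub>N\<^esub> n)
    | m m' n. m \<in> carrier M \<and> m' \<in> carrier M \<and> n \<in> carrier N}"

lemma J1_eq: "J1 K X = Idl\<^bsub>A2\<^esub> gens1"
  by (simp add: J1_def gens1_def)

lemma gens1_closed: "gens1 \<subseteq> carrier A2"
  by (auto simp: gens1_def carriers intro!: four_term_closed2)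

lemma J1_generator:
  "\<lbrakk>m \<in> carrier M; m' \<in> carrier M; n \<in> carrier N\<rbrakk> \<Longrightarrow>
    four_term K A2 (\<one>\<^bsub>L\<^esub>, m' \<otimes>\<^bsub>M\<^esub> m, n) (\<one>\<^bsub>L\<^esub>, m, n) (\<one>\<^bsub>L\<^esub>, m', d1 m \<otimes>\<^bsub>N\<^esub> n)
      (\<one>\<^bsub>L\<^esub>, \<one>\<^bsub>M\<^esub>, d1 m \<otimes>\<^bsub>N\<^esub> n) \<in> J1 K X"
  unfolding J1_eq
  by (rule subsetD[OF ring.genideal_self[OF assoc_algebra_ring[OF algebras(2)] gens1_closed]])
    (auto simp: gens1_def)

lemma ideal_J1: "ideal (J1 K X) A2"
  unfolding J1_eq
  by (rule ring.genideal_ideal[OF assoc_algebra_ring[OF algebras(2)] gens1_closed])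

lemma J1_vanish:
  assumes B: "assoc_algebra K B" and h: "h \<in> algebra_hom K A2 B"
    and gens: "\<And>m m' n. \<lbrakk>m \<in> carrier M; m' \<in> carrier M; n \<in> carrier N\<rbrakk> \<Longrightarrow>
      h (four_term K A2 (\<one>\<^bsub>L\<^esub>, m' \<otimes>\<^bsub>M\<^esub> m, n) (\<one>\<^bsub>L\<^esub>, m, n) (\<one>\<^bsub>L\<^esub>, m', d1 m \<otimes>\<^bsub>N\<^esub> n)
        (\<one>\<^bsub>L\<^esub>, \<one>\<^bsub>M\<^esub>, d1 m \<otimes>\<^bsub>N\<^esub> n)) = \<zero>\<^bsub>B\<^esub>"
    and x: "x \<in> J1 K X"
  shows "h x = \<zero>\<^bsub>B\<^esub>"
  using algebras(2) B h gens1_closed _ x[unfolded J1_eq]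
  by (rule algebra_hom_genideal_zero) (auto simp: gens1_def gens)

definition gens2 where
  "gens2 = {four_term K A3 (l' \<otimes>\<^bsub>L\<^esub> l, m, n) (l, m, n) (l', d2 l \<otimes>\<^bsub>M\<^esub> m, n) (\<one>\<^bsub>L\<^esub>, d2 l \<otimes>\<^bsub>M\<^esub> m, n)
      | l l' m n. l \<in> carrier L \<and> l' \<in> carrier L \<and> m \<in> carrier M \<and> n \<in> carrier N} \<union>
    {four_term K A3 (l' \<otimes>\<^bsub>L\<^esub> actML X m' l, m' \<otimes>\<^bsub>M\<^esub> m, n) (l, m, n) (l', m', d1 m \<otimes>\<^bsub>N\<^esub> n)
        (\<one>\<^bsub>L\<^esub>, \<one>\<^bsub>M\<^esub>, d1 m \<otimes>\<^bsub>N\<^esub> n)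
      | l l' m m' n. l \<in> carrier L \<and> l' \<in> carrier L \<and> m \<in> carrier M \<and> m' \<in> carrier M \<and> n \<in> carrier N} \<union>
    {four_term K A3 (\<one>\<^bsub>L\<^esub>, m' \<otimes>\<^bsub>M\<^esub> m, n) (\<one>\<^bsub>L\<^esub>, m, n) (\<one>\<^bsub>L\<^esub>, m', d1 m \<otimes>\<^bsub>N\<^esub> n)
        (\<one>\<^bsub>L\<^esub>, \<one>\<^bsub>M\<^esub>, d1 m \<otimes>\<^bsub>N\<^esub> n)
      | m m' n. m \<in> carrier M \<and> m' \<in> carrier M \<and> n \<in> carrier N}"

lemma J2_eq: "J2 K X = Idl\<^bsub>A3\<^esub> gens2"
  by (simp add: J2_def gens2_def)

lemma gens2_closed: "gens2 \<subseteq> carrier A3"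
  by (auto simp: gens2_def intro!: four_term_closed3)

lemma gens2_in_J2: "gens2 \<subseteq> J2 K X"
  unfolding J2_eq by (rule ring.genideal_self[OF assoc_algebra_ring[OF algebras(1)] gens2_closed])

lemma J2_generator:
  "\<lbrakk>l \<in> carrier L; l' \<in> carrier L; m \<in> carrier M; n \<in> carrier N\<rbrakk> \<Longrightarrow>
    four_term K A3 (l' \<otimes>\<^bsub>L\<^esub> l, m, n) (l, m, n) (l', d2 l \<otimes>\<^bsub>M\<^esub> m, n) (\<one>\<^bsub>L\<^esub>, d2 l \<otimes>\<^bsub>M\<^esub> m, n) \<in> J2 K X"
  "\<lbrakk>m \<in> carrier M; m' \<in> carrier M; n \<in> carrier N\<rbrakk> \<Longrightarrow>
    four_term K A3 (\<one>\<^bsub>L\<^esub>, m' \<otimes>\<^bsub>M\<^esub> m, n) (\<one>\<^bsub>L\<^esub>, m, n) (\<one>\<^bsub>L\<^esub>, m', d1 m \<otimes>\<^bsub>N\<^esub> n)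
      (\<one>\<^bsub>L\<^esub>, \<one>\<^bsub>M\<^esub>, d1 m \<otimes>\<^bsub>N\<^esub> n) \<in> J2 K X"
  by (rule subsetD[OF gens2_in_J2], unfold gens2_def Un_iff mem_Collect_eq, iprover)+

lemma ideal_J2: "ideal (J2 K X) A3"
  unfolding J2_eq
  by (rule ring.genideal_ideal[OF assoc_algebra_ring[OF algebras(1)] gens2_closed])

lemma J2_vanish:
  assumes B: "assoc_algebra K B" and h: "h \<in> algebra_hom K A3 B"
    and gens: "\<And>l l' m n. \<lbrakk>l \<in> carrier L; l' \<in> carrier L; m \<in> carrier M; n \<in> carrier N\<rbrakk> \<Longrightarrow>
      h (four_term K A3 (l' \<otimes>\<^bsub>L\<^esub> l, m, n) (l, m, n) (l', d2 l \<otimes>\<^bsub>M\<^esub> m, n) (\<one>\<^bsub>L\<^esub>, d2 l \<otimes>\<^bsub>M\<^esub> m, n)) = \<zero>\<^bsub>B\<^esub>"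
    "\<And>l l' m m' n. \<lbrakk>l \<in> carrier L; l' \<in> carrier L; m \<in> carrier M; m' \<in> carrier M; n \<in> carrier N\<rbrakk> \<Longrightarrow>
      h (four_term K A3 (l' \<otimes>\<^bsub>L\<^esub> actML X m' l, m' \<otimes>\<^bsub>M\<^esub> m, n) (l, m, n) (l', m', d1 m \<otimes>\<^bsub>N\<^esub> n)
        (\<one>\<^bsub>L\<^esub>, \<one>\<^bsub>M\<^esub>, d1 m \<otimes>\<^bsub>N\<^esub> n)) = \<zero>\<^bsub>B\<^esub>"
    and x: "x \<in> J2 K X"
  shows "h x = \<zero>\<^bsub>B\<^esub>"
proof -
  \<comment> \<open>The third family is the second one at \<open>l = l' = 1\<close>.\<close>
  have third: "h (four_term K A3 (\<one>\<^bsub>L\<^esub>, m' \<otimes>\<^bsub>M\<^esub> m, n) (\<one>\<^bsub>L\<^esub>, m, n) (\<one>\<^bsub>L\<^esub>, m', d1 m \<otimes>\<^bsub>N\<^esub> n)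
      (\<one>\<^bsub>L\<^esub>, \<one>\<^bsub>M\<^esub>, d1 m \<otimes>\<^bsub>N\<^esub> n)) = \<zero>\<^bsub>B\<^esub>"
    if "m \<in> carrier M" "m' \<in> carrier M" "n \<in> carrier N" for m m' n
    using gens(2)[of "\<one>\<^bsub>L\<^esub>" "\<one>\<^bsub>L\<^esub>" m m' n] that by simp
  have "h g = \<zero>\<^bsub>B\<^esub>" if "g \<in> gens2" for g
    using that unfolding gens2_def Un_iff mem_Collect_eq
    by (elim disjE exE conjE) (simp_all only: gens third)
  with algebras(1) B h gens2_closed show ?thesis
    using x[unfolded J2_eq] by (rule algebra_hom_genideal_zero)
qed

sublocale J1: algebra_ideal K A2 "J1 K X"
  by (rule algebra_ideal.intro[OF algebras(2) ideal_J1])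

sublocale J2: algebra_ideal K A3 "J2 K X"
  by (rule algebra_ideal.intro[OF algebras(1) ideal_J2])

text \<open>Eta-contraction would turn \<open>\<lambda>(l, m, n). (1, m, n)\<close> into \<open>\<lambda>(l, y). (1, y)\<close>, which no longer matches
  the rules about the structural maps.\<close>

declare [[simproc del: case_prod_eta]]

lemma bar_algebras: "assoc_algebra K (bar_LMN K X)" "assoc_algebra K (bar_MN K X)"
  unfolding bar_LMN_def bar_MN_def by (rule J2.assoc_algebra_quotient J1.assoc_algebra_quotient)+

lemmas coset_hom3 = J2.coset_hom[folded bar_LMN_def]
lemmas coset_hom2 = J1.coset_hom[folded bar_MN_def]

lemma s2_J1: "x \<in> J1 K X \<Longrightarrow> s2 x = \<zero>\<^bsub>A1\<^esub>"
  using algebras(3) s2_hom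
  by (rule J1_vanish)
    (simp add: four_term_linear_ext2[OF algebras(3) s2_hom] carriers alg_N_def
      K.four_term_degenerate monoids)

lemma t2_J1: "x \<in> J1 K X \<Longrightarrow> t2 x = \<zero>\<^bsub>A1\<^esub>"
  using algebras(3) t2_hom
  by (rule J1_vanish)
    (simp add: four_term_linear_ext2[OF algebras(3) t2_hom] carriers alg_N_def
      K.four_term_degenerate monoids N.m_assoc)

lemma incl_J1: "x \<in> J1 K X \<Longrightarrow> J2 K X +>\<^bsub>A3\<^esub> x = \<zero>\<^bsub>bar_LMN K X\<^esub>"
  using bar_algebras(1) algebra_hom_compose[OF incl3 coset_hom3]
  by (rule J1_vanish)
    (simp add: four_term_incl carriers bar_LMN_def J2.coset_eq_zero_iff four_term_closed3 J2_generator)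

text \<open>The inclusion of group algebras followed by the projection modulo \<open>J\<^sub>2\<close> vanishes on the generators
  of \<open>J\<^sub>1\<close>, since they reappear among those of \<open>J\<^sub>2\<close>.\<close>

lemma J1_subset_J2: "J1 K X \<subseteq> J2 K X"
proof
  fix x assume x: "x \<in> J1 K X"
  then have "x \<in> carrier A3"
    by (rule algebra_homD(1)[OF incl3 J1.J.Icarr])
  then show "x \<in> J2 K X"
    using incl_J1[OF x] by (simp add: bar_LMN_def J2.coset_eq_zero_iff)
qed

lemma four_term2_degenerate:
  assumes "a \<in> carrier G2" "b \<in> carrier G2"
  shows "four_term K A2 a a b b \<in> J1 K X" "four_term K A2 a b a b \<in> J1 K X"
  using assms additive_subgroup.zero_closed[OF J1.J.is_additive_subgroup]
  unfolding alg_MN_def by (simp_all only: K.four_term_degenerate[OF monoids(2)])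

lemma s3_J2: "x \<in> J2 K X \<Longrightarrow> J1 K X +>\<^bsub>A2\<^esub> s3 x = \<zero>\<^bsub>bar_MN K X\<^esub>"
  using bar_algebras(2) algebra_hom_compose[OF s3_hom coset_hom2]
  by (rule J2_vanish)
    (simp_all add: four_term_linear_ext3[OF algebras(2) s3_hom] bar_MN_def
      J1.coset_eq_zero_iff four_term_closed2 four_term2_degenerate J1_generator carriers)

text \<open>The second family of generators is sent to the generator of \<open>J\<^sub>1\<close> for \<open>\<partial>\<^sub>2l m\<close> and \<open>\<partial>\<^sub>2l' m'\<close>:
  the first entries agree because \<open>\<partial>\<^sub>2(\<^bsup>m'\<^esup>l) m' = m' \<partial>\<^sub>2l\<close>, and the others because
  \<open>\<partial>\<^sub>1\<partial>\<^sub>2 = 1\<close>.\<close>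

lemma t3_J2: "x \<in> J2 K X \<Longrightarrow> J1 K X +>\<^bsub>A2\<^esub> t3 x = \<zero>\<^bsub>bar_MN K X\<^esub>"
  using bar_algebras(2) algebra_hom_compose[OF t3_hom coset_hom2]
proof (rule J2_vanish)
  fix l l' m n assume "l \<in> carrier L" "l' \<in> carrier L" "m \<in> carrier M" "n \<in> carrier N"
  then show "J1 K X +>\<^bsub>A2\<^esub> t3 (four_term K A3 (l' \<otimes>\<^bsub>L\<^esub> l, m, n) (l, m, n)
      (l', d2 l \<otimes>\<^bsub>M\<^esub> m, n) (\<one>\<^bsub>L\<^esub>, d2 l \<otimes>\<^bsub>M\<^esub> m, n)) = \<zero>\<^bsub>bar_MN K X\<^esub>"
    by (simp add: four_term_linear_ext3[OF algebras(2) t3_hom] bar_MN_def J1.coset_eq_zero_iff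
      four_term_closed2 four_term2_degenerate carriers M.m_assoc)
next
  fix l l' m m' n
  assume *: "l \<in> carrier L" "l' \<in> carrier L" "m \<in> carrier M" "m' \<in> carrier M" "n \<in> carrier N"
  have eq: "d2 l' \<otimes>\<^bsub>M\<^esub> (m' \<otimes>\<^bsub>M\<^esub> (d2 l \<otimes>\<^bsub>M\<^esub> inv\<^bsub>M\<^esub> m')) \<otimes>\<^bsub>M\<^esub> (m' \<otimes>\<^bsub>M\<^esub> m) =
      d2 l' \<otimes>\<^bsub>M\<^esub> m' \<otimes>\<^bsub>M\<^esub> (d2 l \<otimes>\<^bsub>M\<^esub> m)"
    using * by (simp add: M.m_assoc M.mult_inv_cancel)
  have "four_term K A2 (\<one>\<^bsub>L\<^esub>, d2 l' \<otimes>\<^bsub>M\<^esub> m' \<otimes>\<^bsub>M\<^esub> (d2 l \<otimes>\<^bsub>M\<^esub> m), n) (\<one>\<^bsub>L\<^esub>, d2 l \<otimes>\<^bsub>M\<^esub> m, n)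
      (\<one>\<^bsub>L\<^esub>, d2 l' \<otimes>\<^bsub>M\<^esub> m', d1 m \<otimes>\<^bsub>N\<^esub> n) (\<one>\<^bsub>L\<^esub>, \<one>\<^bsub>M\<^esub>, d1 m \<otimes>\<^bsub>N\<^esub> n) \<in> J1 K X"
    using J1_generator[of "d2 l \<otimes>\<^bsub>M\<^esub> m" "d2 l' \<otimes>\<^bsub>M\<^esub> m'" n] * by (simp add: complex)
  then show "J1 K X +>\<^bsub>A2\<^esub> t3 (four_term K A3 (l' \<otimes>\<^bsub>L\<^esub> actML X m' l, m' \<otimes>\<^bsub>M\<^esub> m, n) (l, m, n)
      (l', m', d1 m \<otimes>\<^bsub>N\<^esub> n) (\<one>\<^bsub>L\<^esub>, \<one>\<^bsub>M\<^esub>, d1 m \<otimes>\<^bsub>N\<^esub> n)) = \<zero>\<^bsub>bar_MN K X\<^esub>"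
    using * by (simp add: four_term_linear_ext3[OF algebras(2) t3_hom] bar_MN_def
        J1.coset_eq_zero_iff four_term_closed2 carriers bd2_actML eq M.m_assoc M.mult_inv_cancel)
qed

lemma sigma2_eq: "x \<in> carrier A2 \<Longrightarrow> sigma2_bar K X (J1 K X +>\<^bsub>A2\<^esub> x) = s2 x"
  unfolding sigma2_bar_def by (rule J1.coset_map_eq[OF algebras(3) s2_hom s2_J1])

lemma sigma2_hom: "sigma2_bar K X \<in> algebra_hom K (bar_MN K X) A1"
  using J1.coset_map_hom[OF algebras(3) s2_hom s2_J1] unfolding sigma2_bar_def bar_MN_def .

lemma tau2_eq: "x \<in> carrier A2 \<Longrightarrow> tau2_bar K X (J1 K X +>\<^bsub>A2\<^esub> x) = t2 x"
  unfolding tau2_bar_def by (rule J1.coset_map_eq[OF algebras(3) t2_hom t2_J1])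

lemma tau2_hom: "tau2_bar K X \<in> algebra_hom K (bar_MN K X) A1"
  using J1.coset_map_hom[OF algebras(3) t2_hom t2_J1] unfolding tau2_bar_def bar_MN_def .

lemma iota2_hom: "iota2_bar K X \<in> algebra_hom K A1 (bar_MN K X)"
  unfolding iota2_bar_def by (rule algebra_hom_compose[OF incl2 coset_hom2])

lemma sigma3_eq: "x \<in> carrier A3 \<Longrightarrow> sigma3_bar K X (J2 K X +>\<^bsub>A3\<^esub> x) = J1 K X +>\<^bsub>A2\<^esub> s3 x"
  unfolding sigma3_bar_def by (rule J2.coset_map_eq[OF bar_algebras(2) algebra_hom_compose[OF s3_hom coset_hom2] s3_J2])

lemma sigma3_hom: "sigma3_bar K X \<in> algebra_hom K (bar_LMN K X) (bar_MN K X)"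
  using J2.coset_map_hom[OF bar_algebras(2) algebra_hom_compose[OF s3_hom coset_hom2] s3_J2] unfolding sigma3_bar_def bar_LMN_def .

lemma tau3_eq: "x \<in> carrier A3 \<Longrightarrow> tau3_bar K X (J2 K X +>\<^bsub>A3\<^esub> x) = J1 K X +>\<^bsub>A2\<^esub> t3 x"
  unfolding tau3_bar_def by (rule J2.coset_map_eq[OF bar_algebras(2) algebra_hom_compose[OF t3_hom coset_hom2] t3_J2])

lemma tau3_hom: "tau3_bar K X \<in> algebra_hom K (bar_LMN K X) (bar_MN K X)"
  using J2.coset_map_hom[OF bar_algebras(2) algebra_hom_compose[OF t3_hom coset_hom2] t3_J2] unfolding tau3_bar_def bar_LMN_def .

lemma iota3_eq: "x \<in> carrier A2 \<Longrightarrow> iota3_bar K X (J1 K X +>\<^bsub>A2\<^esub> x) = J2 K X +>\<^bsub>A3\<^esub> x"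
  unfolding iota3_bar_def by (rule J1.coset_map_eq[OF bar_algebras(1) algebra_hom_compose[OF incl3 coset_hom3] incl_J1])

lemma iota3_hom: "iota3_bar K X \<in> algebra_hom K (bar_MN K X) (bar_LMN K X)"
  using J1.coset_map_hom[OF bar_algebras(1) algebra_hom_compose[OF incl3 coset_hom3] incl_J1]
  unfolding iota3_bar_def bar_MN_def .

section \<open>The kernel condition\<close>

text \<open>Let \<open>g = (l, m, n)\<close>, \<open>h = (l', m', n')\<close> and \<open>gh = (l a, b, c)\<close> with \<open>a = \<^sup>m(\<^sup>nl')\<close>. In the first
  product the four terms are those of the generator for the pair \<open>l\<close>, \<open>a\<close>. In the second one
  \<open>\<partial>\<^sub>2l m\<close> acts as conjugation by \<open>l\<close> after \<open>m\<close>, which gives the generator for the pair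
  \<open>l a l\<^sup>-\<^sup>1\<close>, \<open>l\<close>.\<close>

lemma defect_products:
  assumes x: "x \<in> carrier A3" and y: "y \<in> carrier A3"
  shows "(x \<ominus>\<^bsub>A3\<^esub> s3 x) \<otimes>\<^bsub>A3\<^esub> (y \<ominus>\<^bsub>A3\<^esub> t3 y) \<in> J2 K X" (is ?st)
    and "(x \<ominus>\<^bsub>A3\<^esub> t3 x) \<otimes>\<^bsub>A3\<^esub> (y \<ominus>\<^bsub>A3\<^esub> s3 y) \<in> J2 K X" (is ?ts)
proof -
  note [simp] = K.linear_ext_basis K.basis_defect_product[OF monoids(1)]
  note defect = K.defect_product_in_ideal[OF monoids(1) ideal_J2[unfolded alg_LMN_def]]
  show ?st
    unfolding alg_LMN_def
  proof (rule defect[OF s3_endo[unfolded alg_LMN_def] t3_endo[unfolded alg_LMN_def] _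
        x[unfolded alg_LMN_def] y[unfolded alg_LMN_def]])
    fix g h assume "g \<in> carrier G3" "h \<in> carrier G3"
    then obtain l m n l' m' n' where
      g: "g = (l, m, n)" "l \<in> carrier L" "m \<in> carrier M" "n \<in> carrier N" and
      h: "h = (l', m', n')" "l' \<in> carrier L" "m' \<in> carrier M" "n' \<in> carrier N"
      by auto
    define a b c where "a = actML X m (actL X n l')" and "b = m \<otimes>\<^bsub>M\<^esub> actM X n m'" and "c = n \<otimes>\<^bsub>N\<^esub> n'"
    have abc: "a \<in> carrier L" "b \<in> carrier M" "c \<in> carrier N"
      using g h by (simp_all add: a_def b_def c_def)
    have d2a: "m \<otimes>\<^bsub>M\<^esub> (actM X n (d2 l') \<otimes>\<^bsub>M\<^esub> actM X n m') = d2 a \<otimes>\<^bsub>M\<^esub> b"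
      using g h by (simp add: a_def b_def bd2_actML bd2_equivariant M.m_assoc M.mult_inv_cancel)
    have "four_term K A3 (l \<otimes>\<^bsub>L\<^esub> a, b, c) (l, d2 a \<otimes>\<^bsub>M\<^esub> b, c) (a, b, c) (\<one>\<^bsub>L\<^esub>, d2 a \<otimes>\<^bsub>M\<^esub> b, c) \<in> J2 K X"
      unfolding alg_LMN_def using abc g J2_generator(1)[of a l b c]
      by (subst K.four_term_swap[OF monoids(1)]) (simp_all add: alg_LMN_def)
    then show "(basis_elt K g \<ominus>\<^bsub>group_algebra K G3\<^esub> s3 (basis_elt K g)) \<otimes>\<^bsub>group_algebra K G3\<^esub>
        (basis_elt K h \<ominus>\<^bsub>group_algebra K G3\<^esub> t3 (basis_elt K h)) \<in> J2 K X"
      using g h abc d2a by (simp add: alg_LMN_def flip: a_def b_def c_def)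
  qed
  show ?ts
    unfolding alg_LMN_def
  proof (rule defect[OF t3_endo[unfolded alg_LMN_def] s3_endo[unfolded alg_LMN_def] _
        x[unfolded alg_LMN_def] y[unfolded alg_LMN_def]])
    fix g h assume "g \<in> carrier G3" "h \<in> carrier G3"
    then obtain l m n l' m' n' where
      g: "g = (l, m, n)" "l \<in> carrier L" "m \<in> carrier M" "n \<in> carrier N" and
      h: "h = (l', m', n')" "l' \<in> carrier L" "m' \<in> carrier M" "n' \<in> carrier N"
      by auto
    define a b c where "a = actML X m (actL X n l')" and "b = m \<otimes>\<^bsub>M\<^esub> actM X n m'" and "c = n \<otimes>\<^bsub>N\<^esub> n'"
    have abc: "a \<in> carrier L" "b \<in> carrier M" "c \<in> carrier N"
      using g h by (simp_all add: a_def b_def c_def)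
    have conj: "actML X (d2 l \<otimes>\<^bsub>M\<^esub> m) (actL X n l') = l \<otimes>\<^bsub>L\<^esub> a \<otimes>\<^bsub>L\<^esub> inv\<^bsub>L\<^esub> l"
      using g h by (simp add: a_def actML_bd2_mult)
    have assoc: "d2 l \<otimes>\<^bsub>M\<^esub> m \<otimes>\<^bsub>M\<^esub> actM X n m' = d2 l \<otimes>\<^bsub>M\<^esub> b"
      using g h by (simp add: b_def M.m_assoc)
    have "l \<otimes>\<^bsub>L\<^esub> a \<otimes>\<^bsub>L\<^esub> inv\<^bsub>L\<^esub> l \<otimes>\<^bsub>L\<^esub> l = l \<otimes>\<^bsub>L\<^esub> a"
      using g abc by (simp add: L.m_assoc)
    then have "four_term K A3 (l \<otimes>\<^bsub>L\<^esub> a, b, c) (l, b, c) (l \<otimes>\<^bsub>L\<^esub> a \<otimes>\<^bsub>L\<^esub> inv\<^bsub>L\<^esub> l, d2 l \<otimes>\<^bsub>M\<^esub> b, c)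
        (\<one>\<^bsub>L\<^esub>, d2 l \<otimes>\<^bsub>M\<^esub> b, c) \<in> J2 K X"
      using J2_generator(1)[of l "l \<otimes>\<^bsub>L\<^esub> a \<otimes>\<^bsub>L\<^esub> inv\<^bsub>L\<^esub> l" b c] g abc by simp
    then show "(basis_elt K g \<ominus>\<^bsub>group_algebra K G3\<^esub> t3 (basis_elt K g)) \<otimes>\<^bsub>group_algebra K G3\<^esub>
        (basis_elt K h \<ominus>\<^bsub>group_algebra K G3\<^esub> s3 (basis_elt K h)) \<in> J2 K X"
      using g h abc conj assoc by (simp add: alg_LMN_def flip: a_def b_def c_def)
  qed
qed

text \<open>The induced map kills the class of \<open>x\<close> exactly when \<open>h x \<in> J\<^sub>1\<close>. As \<open>J\<^sub>1 \<subseteq> J\<^sub>2\<close>, subtracting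
  \<open>h x\<close> does not change the class of \<open>x\<close>.\<close>

lemma kernel_representative:
  assumes map_eq: "\<And>x. x \<in> carrier A3 \<Longrightarrow> \<theta> (J2 K X +>\<^bsub>A3\<^esub> x) = J1 K X +>\<^bsub>A2\<^esub> h x"
    and h: "h \<in> algebra_hom K A3 A2" and C: "C \<in> a_kernel (bar_LMN K X) (bar_MN K X) \<theta>"
  shows "\<exists>x. x \<in> carrier A3 \<and> x \<ominus>\<^bsub>A3\<^esub> h x \<in> carrier A3 \<and> C = J2 K X +>\<^bsub>A3\<^esub> (x \<ominus>\<^bsub>A3\<^esub> h x)"
proof -
  obtain x where x: "x \<in> carrier A3" and Cx: "C = J2 K X +>\<^bsub>A3\<^esub> x" and "\<theta> C = \<zero>\<^bsub>bar_MN K X\<^esub>"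
    using C unfolding a_kernel_def' bar_LMN_def quotient_algebra_carrier by blast
  then have "J1 K X +>\<^bsub>A2\<^esub> h x = \<zero>\<^bsub>bar_MN K X\<^esub>"
    by (simp add: map_eq)
  then have "h x \<in> J1 K X"
    using x by (simp add: bar_MN_def J1.coset_eq_zero_iff algebra_homD[OF h])
  then have hx: "h x \<in> J2 K X"
    using J1_subset_J2 by blast
  then have closed: "h x \<in> carrier A3"
    by (rule J2.J.Icarr)
  have "x = h x \<oplus>\<^bsub>A3\<^esub> (x \<ominus>\<^bsub>A3\<^esub> h x)"
    using x closed by (simp add: J2.minus_eq J2.a_lcomm J2.r_neg)
  then have "x \<in> J2 K X +>\<^bsub>A3\<^esub> (x \<ominus>\<^bsub>A3\<^esub> h x)"
    using hx unfolding a_r_coset_def' by blast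
  then have "J2 K X +>\<^bsub>A3\<^esub> (x \<ominus>\<^bsub>A3\<^esub> h x) = J2 K X +>\<^bsub>A3\<^esub> x"
    using x closed by (intro J2.J.a_repr_independence') simp_all
  then show ?thesis
    using Cx x closed by (intro exI[of _ x]) simp
qed

lemma coset_product_zero:
  assumes "x \<in> carrier A3" "y \<in> carrier A3" "x \<otimes>\<^bsub>A3\<^esub> y \<in> J2 K X"
  shows "(J2 K X +>\<^bsub>A3\<^esub> x) \<otimes>\<^bsub>bar_LMN K X\<^esub> (J2 K X +>\<^bsub>A3\<^esub> y) = \<zero>\<^bsub>bar_LMN K X\<^esub>"
proof -
  have "J2 K X +>\<^bsub>A3\<^esub> (x \<otimes>\<^bsub>A3\<^esub> y) = \<zero>\<^bsub>bar_LMN K X\<^esub>"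
    unfolding bar_LMN_def using assms by (simp only: J2.coset_eq_zero_iff J2.m_closed)
  then show ?thesis
    by (simp only: algebra_homD(2)[OF coset_hom3 assms(1,2)])
qed

lemma zero_in_kernel:
  assumes "\<theta> \<in> algebra_hom K (bar_LMN K X) (bar_MN K X)"
  shows "\<zero>\<^bsub>bar_LMN K X\<^esub> \<in> a_kernel (bar_LMN K X) (bar_MN K X) \<theta>"
proof -
  interpret ring_hom_ring "bar_LMN K X" "bar_MN K X" \<theta>
    using bar_algebras assms by (rule algebra_hom_ring)
  show ?thesis
    unfolding a_kernel_def' by simp
qed

lemma kernel_condition:
  shows "a_kernel (bar_LMN K X) (bar_MN K X) (sigma3_bar K X) \<cdot>\<^bsub>bar_LMN K X\<^esub>
      a_kernel (bar_LMN K X) (bar_MN K X) (tau3_bar K X) = {\<zero>\<^bsub>bar_LMN K X\<^esub>}" (is ?st)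
    and "a_kernel (bar_LMN K X) (bar_MN K X) (tau3_bar K X) \<cdot>\<^bsub>bar_LMN K X\<^esub>
      a_kernel (bar_LMN K X) (bar_MN K X) (sigma3_bar K X) = {\<zero>\<^bsub>bar_LMN K X\<^esub>}" (is ?ts)
proof -
  interpret B: ring "bar_LMN K X"
    using bar_algebras(1) by (rule assoc_algebra_ring)
  have sigma_rep: "\<exists>x. x \<in> carrier A3 \<and> x \<ominus>\<^bsub>A3\<^esub> s3 x \<in> carrier A3 \<and> C = J2 K X +>\<^bsub>A3\<^esub> (x \<ominus>\<^bsub>A3\<^esub> s3 x)"
    if "C \<in> a_kernel (bar_LMN K X) (bar_MN K X) (sigma3_bar K X)" for C
    using sigma3_eq s3_hom that by (rule kernel_representative)
  have tau_rep: "\<exists>x. x \<in> carrier A3 \<and> x \<ominus>\<^bsub>A3\<^esub> t3 x \<in> carrier A3 \<and> C = J2 K X +>\<^bsub>A3\<^esub> (x \<ominus>\<^bsub>A3\<^esub> t3 x)"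
    if "C \<in> a_kernel (bar_LMN K X) (bar_MN K X) (tau3_bar K X)" for C
    using tau3_eq t3_hom that by (rule kernel_representative)
  show ?st
  proof (intro B.ideal_prod_eq_zero zero_in_kernel sigma3_hom tau3_hom)
    fix C D
    assume "C \<in> a_kernel (bar_LMN K X) (bar_MN K X) (sigma3_bar K X)"
      and "D \<in> a_kernel (bar_LMN K X) (bar_MN K X) (tau3_bar K X)"
    then obtain x y where "x \<in> carrier A3" "x \<ominus>\<^bsub>A3\<^esub> s3 x \<in> carrier A3" "C = J2 K X +>\<^bsub>A3\<^esub> (x \<ominus>\<^bsub>A3\<^esub> s3 x)"
      and "y \<in> carrier A3" "y \<ominus>\<^bsub>A3\<^esub> t3 y \<in> carrier A3" "D = J2 K X +>\<^bsub>A3\<^esub> (y \<ominus>\<^bsub>A3\<^esub> t3 y)"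
      by (metis sigma_rep tau_rep)
    then show "C \<otimes>\<^bsub>bar_LMN K X\<^esub> D = \<zero>\<^bsub>bar_LMN K X\<^esub>"
      by (simp only: coset_product_zero defect_products)
  qed
  show ?ts
  proof (intro B.ideal_prod_eq_zero zero_in_kernel sigma3_hom tau3_hom)
    fix C D
    assume "C \<in> a_kernel (bar_LMN K X) (bar_MN K X) (tau3_bar K X)"
      and "D \<in> a_kernel (bar_LMN K X) (bar_MN K X) (sigma3_bar K X)"
    then obtain x y where "x \<in> carrier A3" "x \<ominus>\<^bsub>A3\<^esub> t3 x \<in> carrier A3" "C = J2 K X +>\<^bsub>A3\<^esub> (x \<ominus>\<^bsub>A3\<^esub> t3 x)"
      and "y \<in> carrier A3" "y \<ominus>\<^bsub>A3\<^esub> s3 y \<in> carrier A3" "D = J2 K X +>\<^bsub>A3\<^esub> (y \<ominus>\<^bsub>A3\<^esub> s3 y)"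
      by (metis tau_rep sigma_rep)
    then show "C \<otimes>\<^bsub>bar_LMN K X\<^esub> D = \<zero>\<^bsub>bar_LMN K X\<^esub>"
      by (simp only: coset_product_zero defect_products)
  qed
qed

section \<open>The two cat\<open>\<^sup>1\<close>-structures\<close>

lemma lower_pre_cat1:
  "pre_cat1_algebra K (bar_MN K X) A1 (sigma2_bar K X) (tau2_bar K X) (iota2_bar K X)"
proof (rule pre_cat1_algebra.intro)
  fix x assume x: "x \<in> carrier A1"
  then show "sigma2_bar K X (iota2_bar K X x) = x" "tau2_bar K X (iota2_bar K X x) = x"
    by (simp_all add: iota2_bar_def sigma2_eq tau2_eq algebra_homD(1)[OF incl2] sections)
qed (rule bar_algebras algebras sigma2_hom tau2_hom iota2_hom)+

lemma upper_pre_cat1: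
  "pre_cat1_algebra K (bar_LMN K X) (bar_MN K X) (sigma3_bar K X) (tau3_bar K X) (iota3_bar K X)"
proof (rule pre_cat1_algebra.intro)
  fix C assume "C \<in> carrier (bar_MN K X)"
  then obtain x where "x \<in> carrier A2" "C = J1 K X +>\<^bsub>A2\<^esub> x"
    unfolding bar_MN_def quotient_algebra_carrier by blast
  then show "sigma3_bar K X (iota3_bar K X C) = C" "tau3_bar K X (iota3_bar K X C) = C"
    by (simp_all add: iota3_eq sigma3_eq tau3_eq algebra_homD(1)[OF incl3] sections)
qed (rule bar_algebras sigma3_hom tau3_hom iota3_hom)+

lemma structure_maps_on_basis:
  assumes "l \<in> carrier L" "m \<in> carrier M" "n \<in> carrier N"
  shows "sigma3_bar K X (bar_elt_LMN K X (l, m, n)) = bar_elt_MN K X (\<one>\<^bsub>L\<^esub>, m, n)"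
    and "tau3_bar K X (bar_elt_LMN K X (l, m, n)) = bar_elt_MN K X (\<one>\<^bsub>L\<^esub>, d2 l \<otimes>\<^bsub>M\<^esub> m, n)"
    and "iota3_bar K X (bar_elt_MN K X (\<one>\<^bsub>L\<^esub>, m, n)) = bar_elt_LMN K X (\<one>\<^bsub>L\<^esub>, m, n)"
    and "sigma2_bar K X (bar_elt_MN K X (\<one>\<^bsub>L\<^esub>, m, n)) = basis_elt K (\<one>\<^bsub>L\<^esub>, \<one>\<^bsub>M\<^esub>, n)"
    and "tau2_bar K X (bar_elt_MN K X (\<one>\<^bsub>L\<^esub>, m, n)) = basis_elt K (\<one>\<^bsub>L\<^esub>, \<one>\<^bsub>M\<^esub>, d1 m \<otimes>\<^bsub>N\<^esub> n)"
    and "iota2_bar K X (basis_elt K (\<one>\<^bsub>L\<^esub>, \<one>\<^bsub>M\<^esub>, n)) = bar_elt_MN K X (\<one>\<^bsub>L\<^esub>, \<one>\<^bsub>M\<^esub>, n)"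
  using assms
  by (simp_all add: bar_elt_LMN_def bar_elt_MN_def sigma3_eq tau3_eq iota3_eq sigma2_eq tau2_eq
      iota2_bar_def basis_closed K.linear_ext_basis)

end

theorem mainTheorem2:
  fixes K :: "('k, 'u) ring_scheme"
    and X :: "('l, 'm, 'n) two_crossed_data"
  assumes "field K"
    and "two_crossed_module X"
  shows "(\<forall>l \<in> carrier (grpL X). \<forall>m \<in> carrier (grpM X). \<forall>n \<in> carrier (grpN X).
        sigma3_bar K X (bar_elt_LMN K X (l, m, n)) = bar_elt_MN K X (\<one>\<^bsub>grpL X\<^esub>, m, n) \<and>
        tau3_bar K X (bar_elt_LMN K X (l, m, n)) =
          bar_elt_MN K X (\<one>\<^bsub>grpL X\<^esub>, bd2 X l \<otimes>\<^bsub>grpM X\<^esub> m, n) \<and>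
        iota3_bar K X (bar_elt_MN K X (\<one>\<^bsub>grpL X\<^esub>, m, n)) = bar_elt_LMN K X (\<one>\<^bsub>grpL X\<^esub>, m, n) \<and>
        sigma2_bar K X (bar_elt_MN K X (\<one>\<^bsub>grpL X\<^esub>, m, n)) =
          basis_elt K (\<one>\<^bsub>grpL X\<^esub>, \<one>\<^bsub>grpM X\<^esub>, n) \<and>
        tau2_bar K X (bar_elt_MN K X (\<one>\<^bsub>grpL X\<^esub>, m, n)) =
          basis_elt K (\<one>\<^bsub>grpL X\<^esub>, \<one>\<^bsub>grpM X\<^esub>, bd1 X m \<otimes>\<^bsub>grpN X\<^esub> n) \<and>
        iota2_bar K X (basis_elt K (\<one>\<^bsub>grpL X\<^esub>, \<one>\<^bsub>grpM X\<^esub>, n)) =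
          bar_elt_MN K X (\<one>\<^bsub>grpL X\<^esub>, \<one>\<^bsub>grpM X\<^esub>, n)) \<and>
      pre_cat1_algebra K (bar_MN K X) (alg_N K X) (sigma2_bar K X) (tau2_bar K X) (iota2_bar K X) \<and>
      cat1_algebra K (bar_LMN K X) (bar_MN K X) (sigma3_bar K X) (tau3_bar K X) (iota3_bar K X)"
proof -
  interpret crossed_group_algebra K X
    using assms by (rule crossed_group_algebra.intro)
  have "cat1_algebra K (bar_LMN K X) (bar_MN K X) (sigma3_bar K X) (tau3_bar K X) (iota3_bar K X)"
    by (intro cat1_algebra.intro cat1_algebra_axioms.intro upper_pre_cat1 kernel_condition)
  then show ?thesis
    by (intro conjI ballI structure_maps_on_basis lower_pre_cat1)
qed

end
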